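(* The functional $\mathcal{J}=\mathcal{J}_0+\varphi$, where $$\mathcal{J}_0(u,d)=\int_{\Omega,h}\psi(\varepsilon(u),d)\,dV+\int_\Omega g_c\,\gamma(d,\nabla d)\,dV+P_{\mathrm{ext}}(u),\qquad \varphi(d)=\sum_{i=1}^M I_{[d_n(p_i),1]}(d_i),$$ is proper, lower semicontinuous, and coercive on $H^{\mathrm{alg}}$. Furthermore, it is convex in $u$ (for fixed $d$) and convex in $d$ (for fixed $u$).
   Context: **Energy density.** $\mathbb{S}^m$ is the space of real symmetric $m\times m$ matrices with Frobenius norm $|\cdot|_F$. Fix $\mu>0$, $\lambda>-\tfrac23\mu$ and $\psi_0(\varepsilon)=\frac{\lambda}{2}(\operatorname{tr}\varepsilon)^2+\mu\operatorname{tr}(\varepsilon^2)$, assumed strongly convex on $\mathbb{S}^m$ (automatic for $m\le 3$). Let $g:[0,1]\to[0,1]$ be convex, $C^2$, monotone decreasing, $g(0)=1$, $g(1)=0$; let $k>0$. Put $\psi(\varepsilon,d)=[g(d)+k]\psi_0^+(\varepsilon)+(1+k)\psi_0^-(\varepsilon)$ for $\varepsilon\in\mathbb{S}^m$, $d\in[0,1]$. With $\langle x\rangle_+=\max\{0,x\}$, $\langle x\rangle_-=\min\{0,x\}$, $\operatorname{dev}\varepsilon=\varepsilon-\frac{\operatorname{tr}\varepsilon}{m}I$, the pair $(\psi_0^+,\psi_0^-)$ is one of: (a) $\psi_0^+=\psi_0$, $\psi_0^-=0$; (b) $\psi_0^+=(\frac{\mu}{m}+\frac{\lambda}{2})(\operatorname{tr}\varepsilon)^2$,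 $\psi_0^-=\mu\operatorname{dev}\varepsilon:\operatorname{dev}\varepsilon$; (c) $\psi_0^+=(\frac{\mu}{m}+\frac{\lambda}{2})\langle\operatorname{tr}\varepsilon\rangle_+^2$, $\psi_0^-=(\frac{\mu}{m}+\frac{\lambda}{2})\langle\operatorname{tr}\varepsilon\rangle_-^2+\mu\operatorname{dev}\varepsilon:\operatorname{dev}\varepsilon$; (d) (only if $\lambda\ge0$) $\psi_0^\pm=\frac{\lambda}{2}\langle\sum_i\lambda_i(\varepsilon)\rangle_\pm^2+\mu\sum_i\langle\lambda_i(\varepsilon)\rangle_\pm^2$, where $\lambda_i(\varepsilon)$ are the eigenvalues of $\varepsilon$. **Crack surface density.** $\gamma(d,\nabla d)=\frac{1}{4c_w}\big(\frac{w(d)}{l}+l|\nabla d|^2\big)$ with $l>0$, $w(d)=(1+\beta(1-d))d$, $\beta\in[-1,0]$, $c_w=\int_0^1\sqrt{w(s)}\,ds$; $g_c>0$ is a constant. **Discretization.** $\Omega\subset\mathbb{R}^m$ is a bounded polyhedral domain with a conforming finite element grid $\mathcal{G}$, with nodes $\mathcal{N}=\{p_1,\dots,p_M\}$ and first-order Lagrange nodal basis $\theta_1,\dots,\theta_M$. Finite element functions $u:\Omega\to\mathbb{R}^m$, $d:\Omega\to\mathbb{R}$ are identified with their nodal coefficients $u\in\mathbb{R}^{M,m}$, $d\in\mathbb{R}^M$, and $\varepsilon(u)=\frac12(\nabla u+\nabla u^T)$. For $f$ on $\Omega$, $\int_{\Omega,h}f\,dV=\sum_{e\in\mathcal{G}}\sum_{\alpha=1}^{\alpha_{\max}}f(q_{e,\alpha})\omega_{e,\alpha}$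 is a quadrature rule with points $q_{e,\alpha}\in e$ and positive weights, which on each element integrates $|\varepsilon(u)|_F^2$ exactly for every finite element function $u$. $P_{\mathrm{ext}}$ is a linear functional of $u$. $I_K$ is $0$ on $K$ and $\infty$ elsewhere, and $\mathcal{J}(u,d)=\infty$ wherever $\varphi(d)=\infty$. $\Gamma_{D,u},\Gamma_{D,d}\subset\partial\Omega$ and boundary values $u_0,d_0$ are given, and $H^{\mathrm{alg}}$ is the affine space of $(u,d)\in\mathbb{R}^{M,m}\times\mathbb{R}^M$ with $u(p)=u_0(p)$ for all $p\in\mathcal{N}\cap\Gamma_{D,u}$ and $d(p)=d_0(p)$ for all $p\in\mathcal{N}\cap\Gamma_{D,d}$. The set $\mathcal{N}\cap\Gamma_{D,u}$ is assumed to contain all vertices of at least one boundary grid face. The previous damage $d_n$ has nodal values $d_n(p_i)\in[0,1]$ and satisfies the damage boundary condition. Proper means not identically $\infty$ and never $-\infty$; coercive means $\mathcal{J}(u,d)\to\infty$ as $\|(u,d)\|\to\infty$ in $H^{\mathrm{alg}}$. *)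

theory Defs
  imports "HOL-Analysis.Analysis"
begin

definition sym_matrices :: "(real^'m^'m) set" where
  "sym_matrices = {E. transpose E = E}"

definition dev :: "real^'m^'m \<Rightarrow> real^'m^'m" where
  "dev E = E - (trace E / real CARD('m)) *\<^sub>R mat 1"

definition psi0 :: "real \<Rightarrow> real \<Rightarrow> real^'m^'m \<Rightarrow> real" where
  "psi0 mu lam E = lam / 2 * (trace E)\<^sup>2 + mu * trace (E ** E)"

text \<open>The norm and inner product of \<^typ>\<open>real^'m^'m\<close> are the Frobenius norm and the product
  \<open>A : B\<close>.\<close>

definition strongly_convex_on :: "'a::real_normed_vector set \<Rightarrow> ('a \<Rightarrow> real) \<Rightarrow> bool" where
  "strongly_convex_on S f \<longleftrightarrow> (\<exists>c>0. \<forall>x\<in>S. \<forall>y\<in>S. \<forall>t\<in>{0..1}.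
     f ((1 - t) *\<^sub>R x + t *\<^sub>R y)
       \<le> (1 - t) * f x + t * f y - c / 2 * t * (1 - t) * (norm (x - y))\<^sup>2)"

text \<open>The sum of \<open>h (\<lambda>\<^sub>i E)\<close> over the eigenvalues of a symmetric matrix, each distinct eigenvalue
  being repeated according to the dimension of its eigenspace.\<close>

definition eigenspace :: "real^'m^'m \<Rightarrow> real \<Rightarrow> (real^'m) set" where
  "eigenspace E t = {v. E *v v = t *\<^sub>R v}"

definition sum_eigenvalues :: "(real \<Rightarrow> real) \<Rightarrow> real^'m^'m \<Rightarrow> real" where
  "sum_eigenvalues h E =
     (\<Sum>t\<in>{t. \<exists>v. v \<noteq> 0 \<and> v \<in> eigenspace E t}. real (dim (eigenspace E t)) * h t)"

text \<open>The four admissible pairs \<open>(\<psi>\<^sub>0\<^sup>+, \<psi>\<^sub>0\<^sup>-)\<close>; only the values on symmetric matrices matter.\<close>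

definition split_a where
  "split_a mu lam \<psi>p \<psi>m \<longleftrightarrow> (\<forall>E\<in>sym_matrices. \<psi>p E = psi0 mu lam E \<and> \<psi>m E = 0)"

definition split_b where
  "split_b mu lam \<psi>p \<psi>m \<longleftrightarrow> (\<forall>E\<in>(sym_matrices :: (real^'m^'m) set).
     \<psi>p E = (mu / real CARD('m) + lam / 2) * (trace E)\<^sup>2 \<and>
     \<psi>m E = mu * (dev E \<bullet> dev E))"

definition split_c where
  "split_c mu lam \<psi>p \<psi>m \<longleftrightarrow> (\<forall>E\<in>(sym_matrices :: (real^'m^'m) set).
     \<psi>p E = (mu / real CARD('m) + lam / 2) * (max 0 (trace E))\<^sup>2 \<and>
     \<psi>m E = (mu / real CARD('m) + lam / 2) * (min 0 (trace E))\<^sup>2 + mu * (dev E \<bullet> dev E))"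

definition split_d where
  "split_d mu lam \<psi>p \<psi>m \<longleftrightarrow> lam \<ge> 0 \<and> (\<forall>E\<in>(sym_matrices :: (real^'m^'m) set).
     \<psi>p E = lam / 2 * (max 0 (sum_eigenvalues (\<lambda>t. t) E))\<^sup>2
              + mu * sum_eigenvalues (\<lambda>t. (max 0 t)\<^sup>2) E \<and>
     \<psi>m E = lam / 2 * (min 0 (sum_eigenvalues (\<lambda>t. t) E))\<^sup>2
              + mu * sum_eigenvalues (\<lambda>t. (min 0 t)\<^sup>2) E)"

definition energy_split ::
  "real \<Rightarrow> real \<Rightarrow> (real^'m^'m \<Rightarrow> real) \<Rightarrow> (real^'m^'m \<Rightarrow> real) \<Rightarrow> bool" where
  "energy_split mu lam \<psi>p \<psi>m \<longleftrightarrow>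
     split_a mu lam \<psi>p \<psi>m \<or> split_b mu lam \<psi>p \<psi>m \<or>
     split_c mu lam \<psi>p \<psi>m \<or> split_d mu lam \<psi>p \<psi>m"

definition C2_on :: "real set \<Rightarrow> (real \<Rightarrow> real) \<Rightarrow> bool" where
  "C2_on S g \<longleftrightarrow> (\<exists>g' g''.
     (\<forall>x\<in>S. (g has_real_derivative g' x) (at x within S)) \<and>
     (\<forall>x\<in>S. (g' has_real_derivative g'' x) (at x within S)) \<and>
     continuous_on S g'')"

definition degradation_function :: "(real \<Rightarrow> real) \<Rightarrow> bool" where
  "degradation_function g \<longleftrightarrow>
     g ` {0..1} \<subseteq> {0..1} \<and> convex_on {0..1} g \<and> C2_on {0..1} g \<and>
     monotone_on {0..1} (\<le>) (\<ge>) g \<and> g 0 = 1 \<and> g 1 = 0"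

definition psi ::
  "(real \<Rightarrow> real) \<Rightarrow> real \<Rightarrow> (real^'m^'m \<Rightarrow> real) \<Rightarrow> (real^'m^'m \<Rightarrow> real)
     \<Rightarrow> real^'m^'m \<Rightarrow> real \<Rightarrow> real" where
  "psi g k \<psi>p \<psi>m E d = (g d + k) * \<psi>p E + (1 + k) * \<psi>m E"

definition crack_w :: "real \<Rightarrow> real \<Rightarrow> real" where
  "crack_w \<beta> d = (1 + \<beta> * (1 - d)) * d"

definition crack_c :: "real \<Rightarrow> real" where
  "crack_c \<beta> = integral {0..1} (\<lambda>s. sqrt (crack_w \<beta> s))"

definition crack_density :: "real \<Rightarrow> real \<Rightarrow> real \<Rightarrow> real^'m \<Rightarrow> real" where
  "crack_density \<beta> l d Dd =
     1 / (4 * crack_c \<beta>) * (crack_w \<beta> d / l + l * (norm Dd)\<^sup>2)"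

definition polyhedral_domain :: "('a::euclidean_space) set \<Rightarrow> bool" where
  "polyhedral_domain \<Omega> \<longleftrightarrow> open \<Omega> \<and> connected \<Omega> \<and> bounded \<Omega> \<and> \<Omega> \<noteq> {} \<and>
     (\<exists>\<P>. finite \<P> \<and> (\<forall>P\<in>\<P>. polytope P) \<and> \<Omega> = interior (\<Union>\<P>))"

text \<open>Reference cells are products of unit simplices, one for each block of a partition \<open>\<B>\<close> of the
  coordinates: one block gives the unit simplex, singleton blocks the unit cube, and
  intermediate partitions prisms. The functions that are affine in the variables of
  each block separately are then the usual first-order (\<open>P\<^sub>1\<close>, \<open>Q\<^sub>1\<close>, prismatic) shape functions.\<close>

definition ref_cell :: "'m set set \<Rightarrow> (real^'m) set" where
  "ref_cell \<B> = {x. (\<forall>i. 0 \<le> x $ i) \<and> (\<forall>B\<in>\<B>. (\<Sum>i\<in>B. x $ i) \<le> 1)}"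

definition blockwise_affine :: "'m set set \<Rightarrow> (real^'m \<Rightarrow> 'b::real_vector) \<Rightarrow> bool" where
  "blockwise_affine \<B> f \<longleftrightarrow> (\<forall>B\<in>\<B>. \<forall>x y t. (\<forall>i. i \<notin> B \<longrightarrow> x $ i = y $ i) \<longrightarrow>
     f ((1 - t) *\<^sub>R x + t *\<^sub>R y) = (1 - t) *\<^sub>R f x + t *\<^sub>R f y)"

definition vertices :: "'a::real_vector set \<Rightarrow> 'a set" where
  "vertices S = {v. v extreme_point_of S}"

text \<open>A polytope \<open>e\<close> parametrised over the reference cell by a first-order (isoparametric) map \<open>F\<close>.
  For simplices \<open>F\<close> is affine.\<close>

definition lagrange_element :: "'m set set \<Rightarrow> (real^'m \<Rightarrow> real^'m) \<Rightarrow> (real^'m) set \<Rightarrow> bool" where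
  "lagrange_element \<B> F e \<longleftrightarrow>
     partition_on UNIV \<B> \<and> polytope e \<and>
     blockwise_affine \<B> F \<and> inj_on F (ref_cell \<B>) \<and> F ` ref_cell \<B> = e \<and>
     (\<forall>x\<in>ref_cell \<B>. det (jacobian F (at x)) \<noteq> 0) \<and>
     F ` vertices (ref_cell \<B>) = vertices e"

text \<open>A grid is a finite set \<open>\<G>\<close> of elements, together with the cell type \<open>\<B> e\<close> and the
  parametrisation \<open>F e\<close> of each \<open>e \<in> \<G>\<close>. Elements that do not meet intersect in the empty face.\<close>

definition conforming_grid ::
  "(real^'m) set \<Rightarrow> (real^'m) set set \<Rightarrow> ((real^'m) set \<Rightarrow> 'm set set)
     \<Rightarrow> ((real^'m) set \<Rightarrow> real^'m \<Rightarrow> real^'m) \<Rightarrow> bool" where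
  "conforming_grid \<Omega> \<G> \<B> F \<longleftrightarrow>
     finite \<G> \<and> \<Union>\<G> = closure \<Omega> \<and>
     (\<forall>e\<in>\<G>. lagrange_element (\<B> e) (F e) e) \<and>
     (\<forall>e\<in>\<G>. \<forall>e'\<in>\<G>. (e \<inter> e') face_of e \<and> (e \<inter> e') face_of e')"

definition grid_nodes :: "(real^'m) set set \<Rightarrow> (real^'m) set" where
  "grid_nodes \<G> = (\<Union>e\<in>\<G>. vertices e)"

definition boundary_grid_face :: "(real^'m) set \<Rightarrow> (real^'m) set set \<Rightarrow> (real^'m) set \<Rightarrow> bool" where
  "boundary_grid_face \<Omega> \<G> f \<longleftrightarrow> (\<exists>e\<in>\<G>. f facet_of e) \<and> f \<subseteq> frontier \<Omega>"

definition lagrange_space ::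
  "(real^'m) set \<Rightarrow> (real^'m) set set \<Rightarrow> ((real^'m) set \<Rightarrow> 'm set set)
     \<Rightarrow> ((real^'m) set \<Rightarrow> real^'m \<Rightarrow> real^'m) \<Rightarrow> (real^'m \<Rightarrow> real) set" where
  "lagrange_space \<Omega> \<G> \<B> F = {v. continuous_on (closure \<Omega>) v \<and>
     (\<forall>e\<in>\<G>. \<exists>w. blockwise_affine (\<B> e) w \<and> (\<forall>x\<in>ref_cell (\<B> e). v (F e x) = w x))}"

text \<open>The finite index type \<open>'n\<close> plays the role of \<open>{1..M}\<close>.\<close>

definition lagrange_nodal_basis ::
  "(real^'m) set \<Rightarrow> (real^'m) set set \<Rightarrow> ((real^'m) set \<Rightarrow> 'm set set)
     \<Rightarrow> ((real^'m) set \<Rightarrow> real^'m \<Rightarrow> real^'m)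
     \<Rightarrow> ('n \<Rightarrow> real^'m) \<Rightarrow> ('n \<Rightarrow> real^'m \<Rightarrow> real) \<Rightarrow> bool" where
  "lagrange_nodal_basis \<Omega> \<G> \<B> F p \<theta> \<longleftrightarrow>
     inj p \<and> range p = grid_nodes \<G> \<and>
     (\<forall>i. \<theta> i \<in> lagrange_space \<Omega> \<G> \<B> F) \<and>
     (\<forall>i j. \<theta> i (p j) = (if i = j then 1 else 0))"

definition fe_fun ::
  "('n::finite \<Rightarrow> real^'m \<Rightarrow> real) \<Rightarrow> 'b::real_vector^'n \<Rightarrow> real^'m \<Rightarrow> 'b" where
  "fe_fun \<theta> c x = (\<Sum>i\<in>UNIV. \<theta> i x *\<^sub>R c $ i)"

text \<open>Derivatives are taken within a set \<open>S\<close>: the gradient of a finite element function jumps across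
  element boundaries, so at a quadrature point \<open>q \<in> e\<close> (possibly on the boundary of \<open>e\<close>) the
  one-sided value belonging to \<open>e\<close> is meant, obtained with \<open>S = e\<close>. For \<open>S = \<Omega>\<close> open this is
  the ordinary derivative, which exists almost everywhere.\<close>

definition strain :: "(real^'m) set \<Rightarrow> (real^'m \<Rightarrow> real^'m) \<Rightarrow> real^'m \<Rightarrow> real^'m^'m" where
  "strain S v x = (1/2) *\<^sub>R (jacobian v (at x within S) + transpose (jacobian v (at x within S)))"

definition gradient :: "(real^'m) set \<Rightarrow> (real^'m \<Rightarrow> real) \<Rightarrow> real^'m \<Rightarrow> real^'m" where
  "gradient S v x = (\<chi> i. frechet_derivative v (at x within S) (axis i 1))"

text \<open>The integrand gets the element as an extra argument, see the remark on derivatives above.\<close>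

definition quad_sum ::
  "(real^'m) set set \<Rightarrow> nat \<Rightarrow> ((real^'m) set \<Rightarrow> nat \<Rightarrow> real^'m) \<Rightarrow> ((real^'m) set \<Rightarrow> nat \<Rightarrow> real)
     \<Rightarrow> ((real^'m) set \<Rightarrow> real^'m \<Rightarrow> real) \<Rightarrow> real" where
  "quad_sum \<G> amax q \<omega> f = (\<Sum>e\<in>\<G>. \<Sum>\<alpha>=1..amax. f e (q e \<alpha>) * \<omega> e \<alpha>)"

definition admissible_quadrature ::
  "(real^'m) set set \<Rightarrow> ('n::finite \<Rightarrow> real^'m \<Rightarrow> real)
     \<Rightarrow> nat \<Rightarrow> ((real^'m) set \<Rightarrow> nat \<Rightarrow> real^'m) \<Rightarrow> ((real^'m) set \<Rightarrow> nat \<Rightarrow> real) \<Rightarrow> bool" where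
  "admissible_quadrature \<G> \<theta> amax q \<omega> \<longleftrightarrow>
     (\<forall>e\<in>\<G>. \<forall>\<alpha>\<in>{1..amax}. q e \<alpha> \<in> e \<and> \<omega> e \<alpha> > 0) \<and>
     (\<forall>e\<in>\<G>. \<forall>u :: real^'m^'n.
        (\<Sum>\<alpha>=1..amax. (norm (strain e (fe_fun \<theta> u) (q e \<alpha>)))\<^sup>2 * \<omega> e \<alpha>)
          = (LINT x:e|lebesgue. (norm (strain e (fe_fun \<theta> u) x))\<^sup>2))"

definition bulk_energy where
  "bulk_energy \<G> \<theta> amax q \<omega> \<Psi> u d =
     quad_sum \<G> amax q \<omega> (\<lambda>e x. \<Psi> (strain e (fe_fun \<theta> u) x) (fe_fun \<theta> d x))"

definition crack_energy where
  "crack_energy \<Omega> \<theta> gc \<beta> l d =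
     (LINT x:\<Omega>|lebesgue. gc * crack_density \<beta> l (fe_fun \<theta> d x) (gradient \<Omega> (fe_fun \<theta> d) x))"

definition ind_ext :: "'a set \<Rightarrow> 'a \<Rightarrow> ereal" where
  "ind_ext K x = (if x \<in> K then 0 else \<infinity>)"

definition irreversibility :: "real^'n \<Rightarrow> real^'n \<Rightarrow> ereal" where
  "irreversibility dn d = (\<Sum>i\<in>UNIV. ind_ext {dn $ i .. 1} (d $ i))"

definition H_alg ::
  "('n \<Rightarrow> real^'m) \<Rightarrow> (real^'m) set \<Rightarrow> (real^'m) set \<Rightarrow> (real^'m \<Rightarrow> real^'m) \<Rightarrow> (real^'m \<Rightarrow> real)
     \<Rightarrow> ((real^'m^'n) \<times> (real^'n)) set" where
  "H_alg p \<Gamma>u \<Gamma>d u0 d0 = {(u, d).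
     (\<forall>i. p i \<in> \<Gamma>u \<longrightarrow> u $ i = u0 (p i)) \<and> (\<forall>i. p i \<in> \<Gamma>d \<longrightarrow> d $ i = d0 (p i))}"

definition proper_on :: "'a set \<Rightarrow> ('a \<Rightarrow> ereal) \<Rightarrow> bool" where
  "proper_on S f \<longleftrightarrow> (\<exists>x\<in>S. f x \<noteq> \<infinity>) \<and> (\<forall>x\<in>S. f x \<noteq> - \<infinity>)"

definition lsc_on :: "'a::topological_space set \<Rightarrow> ('a \<Rightarrow> ereal) \<Rightarrow> bool" where
  "lsc_on S f \<longleftrightarrow> (\<forall>x\<in>S. f x \<le> Liminf (at x within S) f)"

definition coercive_on :: "'a::real_normed_vector set \<Rightarrow> ('a \<Rightarrow> ereal) \<Rightarrow> bool" where
  "coercive_on S f \<longleftrightarrow> (f \<longlongrightarrow> \<infinity>) (inf at_infinity (principal S))"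

definition ereal_convex_on :: "'a::real_vector set \<Rightarrow> ('a \<Rightarrow> ereal) \<Rightarrow> bool" where
  "ereal_convex_on S f \<longleftrightarrow> convex S \<and> (\<forall>x\<in>S. \<forall>y\<in>S. \<forall>t\<in>{0<..<1}.
     f ((1 - t) *\<^sub>R x + t *\<^sub>R y) \<le> ereal (1 - t) * f x + ereal t * f y)"

end

theory Submission
  imports Defs
begin

text \<open>The constrained set of damages is the box \<open>[d\<^sub>n, 1]\<close>, so \<open>J\<close> is \<open>J0\<close> on this box and \<open>\<infinity>\<close> off
  it. Every finite element function is on each element a blockwise affine function of the reference
  coordinates, hence it takes its extreme values at nodes; admissible damages therefore stay in
  \<open>[0, 1]\<close> throughout the domain, where \<open>g\<close> is continuous with values in \<open>[0, 1]\<close> and the crack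
  density is nonnegative (\<open>fe_fun_unit_interval\<close>).

  Convexity. The strain is linear in the displacement and the damage at a point is linear in the
  nodal damages, so it suffices that the two parts of the energy split are convex and nonnegative on
  symmetric matrices (\<open>energy_split_properties\<close>). For the spectral split this is the convexity of
  \<open>E \<mapsto> \<Sum>\<^sub>i h (\<lambda>\<^sub>i E)\<close> for convex \<open>h\<close>, which follows from Jensen's inequality in an orthonormal eigenbasis
  (\<open>convex_on_sum_eigenvalues\<close>). The crack density is convex because \<open>w\<close> is a quadratic with leading
  coefficient \<open>-\<beta> \<ge> 0\<close>.

  Lower semicontinuity. A finite convex function on a Euclidean space is continuous. This gives
  the continuity of the split energies and of the crack energy, and \<open>J\<close> is a continuous function
  restricted to a closed set.

  Coercivity. The two parts of the split add up to \<open>\<psi>\<^sub>0\<close>, which dominates a multiple of the squared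
  Frobenius norm by strong convexity; since \<open>g \<ge> 0\<close>, the bulk energy dominates a multiple
  of the squared discrete \<open>L\<^sup>2\<close> norm of the strain. By exactness of the quadrature this vanishes only for
  displacements that are rigid on every element. A rigid displacement that vanishes on a facet vanishes
  on the whole element, and so the zero set spreads from the Dirichlet face across facets to all of the
  connected domain (\<open>zero_strain_imp_zero\<close>). In finite dimensions definiteness upgrades to a
  quadratic lower bound (\<open>discrete_korn\<close>), which beats the linear external load.\<close>

section \<open>Spectral theory of symmetric matrices\<close>

text \<open>The first-order condition at the minimiser \<open>s = 0\<close>.\<close>

lemma quadratic_nonneg_imp_linear_zero:
  fixes b c :: real
  assumes "\<And>s. 0 \<le> s * b + s\<^sup>2 * c"
  shows "b = 0"
proof (rule ccontr)
  assume "b \<noteq> 0"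
  define K where "K = \<bar>c\<bar> + 1"
  have K: "K > 0" "c \<le> K" by (auto simp: K_def)
  \<comment> \<open>The minimiser of \<open>s * b + s\<^sup>2 * K\<close>, where \<open>K\<close> replaces \<open>c\<close> to be positive.\<close>
  define s where "s = - b / (2 * K)"
  have "s * b + s\<^sup>2 * c \<le> s * b + s\<^sup>2 * K"
    using K by (simp add: mult_left_mono)
  also have "\<dots> = - b\<^sup>2 / (4 * K)"
    unfolding s_def using K by (simp add: field_simps power2_eq_square)
  also have "\<dots> < 0"
    using \<open>b \<noteq> 0\<close> K by (simp add: divide_neg_pos)
  finally show False using assms[of s] by simp
qed

text \<open>A maximiser \<open>v\<close> of the Rayleigh quotient on the unit sphere of \<open>S\<close> is an eigenvector: the first
  variation \<open>M v - f v\<close> is orthogonal to \<open>S\<close>, and it lies in \<open>S\<close> by invariance.\<close>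

lemma self_adjoint_has_eigenvector:
  fixes f :: "'a::euclidean_space \<Rightarrow> 'a"
  assumes f: "linear f" "\<And>x y. f x \<bullet> y = x \<bullet> f y"
    and S: "subspace S" "f ` S \<subseteq> S" "S \<noteq> {0}"
  obtains v t where "v \<in> S" "norm v = 1" "f v = t *\<^sub>R v"
proof -
  have cont: "continuous_on X (\<lambda>x. x \<bullet> f x)" for X
    using linear_continuous_on[OF linear_conv_bounded_linear[THEN iffD1, OF f(1)]]
    by (intro continuous_intros) auto
  obtain x where x: "x \<in> S" "x \<noteq> 0" using S subspace_0 by blast
  have "compact (S \<inter> sphere 0 1)"
    using compact_Int_closed[OF compact_sphere closed_subspace[OF S(1)]] by (simp add: Int_commute)
  moreover have "(1 / norm x) *\<^sub>R x \<in> S \<inter> sphere 0 1"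
    using x S(1) by (simp add: subspace_scale)
  ultimately obtain v where v: "v \<in> S \<inter> sphere 0 1"
    and vmax: "\<And>y. y \<in> S \<inter> sphere 0 1 \<Longrightarrow> y \<bullet> f y \<le> v \<bullet> f v"
    using continuous_attains_sup[OF _ _ cont] by (metis empty_iff)
  define M where "M = v \<bullet> f v"
  have le: "y \<bullet> f y \<le> M * (y \<bullet> y)" if "y \<in> S" for y
  proof (cases "y = 0")
    case False
    define z where "z = (1 / norm y) *\<^sub>R y"
    have "z \<bullet> f z \<le> M" unfolding M_def z_def
      using that False S(1) by (intro vmax) (simp add: subspace_scale)
    moreover have "z \<bullet> f z = (y \<bullet> f y) / (y \<bullet> y)"
      unfolding z_def by (simp add: linear_scale[OF f(1)] dot_square_norm power2_eq_square)
    ultimately show ?thesis using False by (simp add: divide_simps)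
  qed (simp add: linear_0[OF f(1)])
  have "(M *\<^sub>R v - f v) \<bullet> w = 0" if w: "w \<in> S" for w
  proof -
    have "0 \<le> s * (2 * ((M *\<^sub>R v - f v) \<bullet> w)) + s\<^sup>2 * (M * (w \<bullet> w) - w \<bullet> f w)" for s
    proof -
      have "v + s *\<^sub>R w \<in> S" using v w S(1) by (simp add: subspace_add subspace_scale)
      note le[OF this]
      moreover have "v \<bullet> v = 1" using v by (simp add: dot_square_norm)
      moreover have "v \<bullet> f w = f v \<bullet> w" by (simp add: f(2))
      ultimately show ?thesis
        unfolding linear_add[OF f(1)] linear_scale[OF f(1)]
        by (simp add: M_def inner_simps algebra_simps power2_eq_square inner_commute)
    qed
    from quadratic_nonneg_imp_linear_zero[OF this] show ?thesis by simp
  qed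
  moreover have "M *\<^sub>R v - f v \<in> S"
    using v S by (intro subspace_diff) (auto simp: subspace_scale)
  ultimately have "f v = M *\<^sub>R v" by (metis inner_eq_zero_iff right_minus_eq)
  then show ?thesis using that v by auto
qed

text \<open>The orthogonal complement in \<open>S\<close> of an eigenvector is again invariant by self-adjointness, which
  reduces the dimension.\<close>

lemma self_adjoint_eigenbasis_subspace:
  fixes f :: "'a::euclidean_space \<Rightarrow> 'a"
  assumes f: "linear f" "\<And>x y. f x \<bullet> y = x \<bullet> f y"
    and S: "subspace S" "f ` S \<subseteq> S"
  shows "\<exists>B ev. B \<subseteq> S \<and> pairwise orthogonal B \<and> (\<forall>b\<in>B. norm b = 1 \<and> f b = ev b *\<^sub>R b) \<and> span B = S"
  using S
proof (induction "dim S" arbitrary: S rule: less_induct)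
  case less
  show ?case
  proof (cases "S = {0}")
    case True
    then show ?thesis by (intro exI[of _ "{}"]) auto
  next
    case False
    obtain v t where v: "v \<in> S" "norm v = 1" "f v = t *\<^sub>R v"
      using self_adjoint_has_eigenvector[OF f less.prems False] .
    define S' where "S' = {x \<in> S. x \<bullet> v = 0}"
    have sub: "subspace S'"
      using less.prems(1) unfolding S'_def subspace_def by (simp add: inner_simps)
    have inv: "f ` S' \<subseteq> S'"
      using less.prems(2) v(3) unfolding S'_def by (auto simp: f(2))
    have vv: "v \<bullet> v = 1" using v(2) by (simp add: dot_square_norm)
    have "v \<notin> S'" "S' \<subseteq> S" using vv unfolding S'_def by auto
    then have "S' \<subset> S" using v(1) by blast
    then have "dim S' < dim S"
      by (metis dim_psubset less.prems(1) span_eq_iff sub)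
    from less.hyps[OF this sub inv] obtain B ev where
      B: "B \<subseteq> S'" "pairwise orthogonal B" "\<forall>b\<in>B. norm b = 1 \<and> f b = ev b *\<^sub>R b" "span B = S'"
      by blast
    have vB: "v \<notin> B" using B(1) vv unfolding S'_def by auto
    have "S \<subseteq> span (insert v B)"
    proof
      fix x assume x: "x \<in> S"
      have "x - (x \<bullet> v) *\<^sub>R v \<in> S'"
        using x v less.prems(1) vv unfolding S'_def
        by (simp add: inner_simps subspace_diff subspace_scale)
      then show "x \<in> span (insert v B)" using B(4) span_breakdown_eq by blast
    qed
    moreover have "span (insert v B) \<subseteq> S"
      using B(1) v(1) less.prems(1) unfolding S'_def by (intro span_minimal) auto
    moreover have "pairwise orthogonal (insert v B)"
      using B(1,2) unfolding pairwise_insert S'_def orthogonal_def by (auto simp: inner_commute)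
    ultimately show ?thesis
      using B(1,3) v vB unfolding S'_def
      by (intro exI[of _ "insert v B"] exI[of _ "ev(v := t)"]) auto
  qed
qed

definition orthonormal_basis :: "'a::euclidean_space set \<Rightarrow> bool" where
  "orthonormal_basis B \<longleftrightarrow> pairwise orthogonal B \<and> (\<forall>b\<in>B. norm b = 1) \<and> span B = UNIV"

definition orthonormal_eigenbasis :: "real^'m^'m \<Rightarrow> (real^'m) set \<Rightarrow> (real^'m \<Rightarrow> real) \<Rightarrow> bool" where
  "orthonormal_eigenbasis E B ev \<longleftrightarrow> orthonormal_basis B \<and> (\<forall>b\<in>B. E *v b = ev b *\<^sub>R b)"

lemma sym_matrix_inner:
  assumes "E \<in> sym_matrices" shows "(E *v x) \<bullet> y = x \<bullet> (E *v y)"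
proof -
  have E: "transpose E = E" using assms by (simp add: sym_matrices_def)
  have "(transpose E *v x) \<bullet> y = x \<bullet> (E *v y)"
    unfolding transpose_matrix_vector by (rule dot_lmul_matrix)
  then show ?thesis by (simp only: E)
qed

lemma orthonormal_eigenbasis_exists:
  assumes "E \<in> sym_matrices"
  obtains B ev where "orthonormal_eigenbasis E B ev"
proof -
  obtain B ev where "pairwise orthogonal B" "\<forall>b\<in>B. norm b = 1 \<and> E *v b = ev b *\<^sub>R b" "span B = UNIV"
    using self_adjoint_eigenbasis_subspace[of "\<lambda>x. E *v x" UNIV] sym_matrix_inner[OF assms]
    by auto
  then have "orthonormal_eigenbasis E B ev"
    unfolding orthonormal_eigenbasis_def orthonormal_basis_def by blast
  then show thesis by (rule that)
qed

lemma orthonormal_basis_finite: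
  assumes "orthonormal_basis B" shows "finite B" and "independent B"
proof -
  show "independent B"
    using assms unfolding orthonormal_basis_def
    by (intro pairwise_orthogonal_independent) auto
  then show "finite B" by (rule independent_imp_finite)
qed

lemma orthonormal_basis_expansion:
  assumes "orthonormal_basis B"
  shows "(\<Sum>b\<in>B. (b \<bullet> x) *\<^sub>R b) = x"
  using assms orthonormal_basis_finite[OF assms] orthonormal_basis_expand[of B x]
  unfolding orthonormal_basis_def by (simp add: inner_commute)

lemma orthonormal_basis_parseval:
  assumes "orthonormal_basis B"
  shows "x \<bullet> y = (\<Sum>b\<in>B. (b \<bullet> x) * (b \<bullet> y))"
proof -
  have "x \<bullet> y = (\<Sum>b\<in>B. (b \<bullet> x) *\<^sub>R b) \<bullet> y"
    by (simp add: orthonormal_basis_expansion[OF assms])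
  then show ?thesis by (simp add: inner_sum_left)
qed

text \<open>Parseval's identity for two coordinate vectors says \<open>\<Sum>\<^sub>b b\<^sub>i b\<^sub>j = \<delta>\<^sub>i\<^sub>j\<close>.\<close>

lemma trace_orthonormal_basis:
  fixes E :: "real^'m^'m"
  assumes "orthonormal_basis B"
  shows "trace E = (\<Sum>b\<in>B. b \<bullet> (E *v b))"
proof -
  have "(\<Sum>b\<in>B. b \<bullet> (E *v b)) = (\<Sum>b\<in>B. \<Sum>i\<in>UNIV. \<Sum>j\<in>UNIV. E$i$j * (b$i * b$j))"
    by (simp add: inner_vec_def matrix_vector_mult_def sum_distrib_left algebra_simps)
  also have "\<dots> = (\<Sum>i\<in>UNIV. \<Sum>j\<in>UNIV. E$i$j * (\<Sum>b\<in>B. b$i * b$j))"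
    unfolding sum_distrib_left by (subst sum.swap, intro sum.cong refl, subst sum.swap, rule refl)
  also have "\<dots> = (\<Sum>i\<in>UNIV. \<Sum>j\<in>UNIV. E$i$j * (axis i 1 \<bullet> (axis j 1 :: real^'m)))"
    using orthonormal_basis_parseval[OF assms, of "axis _ 1" "axis _ 1"] by (simp add: inner_axis)
  also have "\<dots> = trace E"
    by (simp add: trace_def inner_axis_axis if_distrib cong: if_cong)
  finally show ?thesis by simp
qed

text \<open>Eigenvectors for different eigenvalues are orthogonal, so in the expansion of an eigenvector only
  the basis vectors with the same eigenvalue occur.\<close>

lemma eigenspace_eq_span:
  assumes sym: "E \<in> sym_matrices" and B: "orthonormal_eigenbasis E B ev"
  shows "eigenspace E t = span {b \<in> B. ev b = t}"
proof
  have onb: "orthonormal_basis B" using B by (simp add: orthonormal_eigenbasis_def)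
  show "span {b \<in> B. ev b = t} \<subseteq> eigenspace E t"
  proof (rule span_minimal)
    show "{b \<in> B. ev b = t} \<subseteq> eigenspace E t"
      using B by (auto simp: orthonormal_eigenbasis_def eigenspace_def)
    show "subspace (eigenspace E t)"
      unfolding subspace_def eigenspace_def
      by (simp add: matrix_vector_right_distrib scaleR_add_right matrix_vector_mult_scaleR)
  qed
  show "eigenspace E t \<subseteq> span {b \<in> B. ev b = t}"
  proof
    fix x assume "x \<in> eigenspace E t"
    then have x: "E *v x = t *\<^sub>R x" by (simp add: eigenspace_def)
    have zero: "b \<bullet> x = 0" if "b \<in> B" "ev b \<noteq> t" for b
    proof -
      have "ev b * (b \<bullet> x) = (E *v b) \<bullet> x"
        using B that(1) by (simp add: orthonormal_eigenbasis_def)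
      also have "\<dots> = t * (b \<bullet> x)" by (simp add: sym_matrix_inner[OF sym] x)
      finally show ?thesis using that(2) by simp
    qed
    have "x = (\<Sum>b\<in>B. (b \<bullet> x) *\<^sub>R b)" by (simp add: orthonormal_basis_expansion[OF onb])
    also have "\<dots> = (\<Sum>b\<in>{b \<in> B. ev b = t}. (b \<bullet> x) *\<^sub>R b)"
      using orthonormal_basis_finite[OF onb] zero by (intro sum.mono_neutral_right) auto
    also have "\<dots> \<in> span {b \<in> B. ev b = t}"
      by (intro span_sum span_scale span_base) auto
    finally show "x \<in> span {b \<in> B. ev b = t}" .
  qed
qed

text \<open>Geometric multiplicities count basis vectors, which removes the eigenspaces from all later
  arguments.\<close>

lemma sum_eigenvalues_eigenbasis:
  assumes sym: "E \<in> sym_matrices" and B: "orthonormal_eigenbasis E B ev"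
  shows "sum_eigenvalues h E = (\<Sum>b\<in>B. h (ev b))"
proof -
  have onb: "orthonormal_basis B" using B by (simp add: orthonormal_eigenbasis_def)
  note fin = orthonormal_basis_finite[OF onb]
  have b0: "b \<noteq> 0" if "b \<in> B" for b using onb that unfolding orthonormal_basis_def by (metis norm_zero zero_neq_one)
  have spectrum: "{t. \<exists>v. v \<noteq> 0 \<and> v \<in> eigenspace E t} = ev ` B"
  proof
    show "{t. \<exists>v. v \<noteq> 0 \<and> v \<in> eigenspace E t} \<subseteq> ev ` B"
    proof clarify
      fix t v assume "v \<noteq> 0" "v \<in> eigenspace E t"
      then have "{b \<in> B. ev b = t} \<noteq> {}"
        unfolding eigenspace_eq_span[OF sym B] by (metis singletonD span_empty)
      then show "t \<in> ev ` B" by auto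
    qed
    show "ev ` B \<subseteq> {t. \<exists>v. v \<noteq> 0 \<and> v \<in> eigenspace E t}"
      using b0 unfolding eigenspace_eq_span[OF sym B] by (auto intro: span_base)
  qed
  have mult: "dim (eigenspace E t) = card {b \<in> B. ev b = t}" for t
    unfolding eigenspace_eq_span[OF sym B] dim_span
    by (intro dim_eq_card_independent independent_mono[OF fin(2)]) auto
  have "sum_eigenvalues h E = (\<Sum>t\<in>ev ` B. real (card {b \<in> B. ev b = t}) * h t)"
    unfolding sum_eigenvalues_def spectrum mult ..
  also have "\<dots> = (\<Sum>t\<in>ev ` B. \<Sum>b\<in>{b \<in> B. ev b = t}. h t)"
    unfolding sum_constant ..
  also have "\<dots> = (\<Sum>t\<in>ev ` B. \<Sum>b\<in>{b \<in> B. ev b = t}. h (ev b))"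
    by (intro sum.cong refl) auto
  also have "\<dots> = (\<Sum>b\<in>B. h (ev b))"
    by (rule sum.image_gen[OF fin(1), symmetric])
  finally show ?thesis .
qed

lemma sum_eigenvalues_id:
  assumes "E \<in> sym_matrices" shows "sum_eigenvalues (\<lambda>t. t) E = trace E"
proof -
  obtain B ev where B: "orthonormal_eigenbasis E B ev"
    using orthonormal_eigenbasis_exists[OF assms] .
  then have "(\<Sum>b\<in>B. b \<bullet> (E *v b)) = (\<Sum>b\<in>B. ev b)"
    by (intro sum.cong) (auto simp: orthonormal_eigenbasis_def orthonormal_basis_def dot_square_norm)
  then show ?thesis
    using trace_orthonormal_basis[of B] B
    by (simp add: sum_eigenvalues_eigenbasis[OF assms B] orthonormal_eigenbasis_def)
qed

lemma sum_eigenvalues_square: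
  assumes "E \<in> sym_matrices" shows "sum_eigenvalues (\<lambda>t. t\<^sup>2) E = trace (E ** E)"
proof -
  obtain B ev where B: "orthonormal_eigenbasis E B ev"
    using orthonormal_eigenbasis_exists[OF assms] .
  then have "(\<Sum>b\<in>B. b \<bullet> ((E ** E) *v b)) = (\<Sum>b\<in>B. (ev b)\<^sup>2)"
    by (intro sum.cong) (auto simp: orthonormal_eigenbasis_def orthonormal_basis_def dot_square_norm
        matrix_vector_mul_assoc[symmetric] matrix_vector_mult_scaleR power2_eq_square)
  then show ?thesis
    using trace_orthonormal_basis[of B] B
    by (simp add: sum_eigenvalues_eigenbasis[OF assms B] orthonormal_eigenbasis_def)
qed

lemma sum_eigenvalues_nonneg:
  assumes "\<And>t. h t \<ge> 0" shows "sum_eigenvalues h E \<ge> 0"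
  unfolding sum_eigenvalues_def using assms by (intro sum_nonneg) auto

text \<open>Each diagonal entry is a convex combination of the eigenvalues with weights \<open>(b \<bullet> c)\<^sup>2\<close>. By
  Parseval these weights also sum to one over \<open>c\<close>, so that Jensen's inequality for each \<open>c\<close> adds up
  to the bound (Peierls' inequality).\<close>

lemma sum_diagonal_le_sum_eigenvalues:
  assumes sym: "E \<in> sym_matrices" and h: "convex_on UNIV h" and C: "orthonormal_basis C"
  shows "(\<Sum>c\<in>C. h (c \<bullet> (E *v c))) \<le> sum_eigenvalues h E"
proof -
  obtain B ev where B: "orthonormal_eigenbasis E B ev"
    using orthonormal_eigenbasis_exists[OF sym] .
  then have onb: "orthonormal_basis B" by (simp add: orthonormal_eigenbasis_def)
  have weights: "(\<Sum>b\<in>B. (b \<bullet> c)\<^sup>2) = 1" if "c \<in> C" for c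
    using orthonormal_basis_parseval[OF onb, of c c] that C
    by (auto simp: power2_eq_square orthonormal_basis_def dot_square_norm)
  have weights': "(\<Sum>c\<in>C. (b \<bullet> c)\<^sup>2) = 1" if "b \<in> B" for b
    using orthonormal_basis_parseval[OF C, of b b] that onb
    by (auto simp: power2_eq_square orthonormal_basis_def dot_square_norm inner_commute)
  have "h (c \<bullet> (E *v c)) \<le> (\<Sum>b\<in>B. (b \<bullet> c)\<^sup>2 * h (ev b))" if "c \<in> C" for c
  proof -
    have "c \<bullet> (E *v c) = (\<Sum>b\<in>B. (b \<bullet> c)\<^sup>2 * ev b)"
      unfolding orthonormal_basis_parseval[OF onb, of c "E *v c"]
      using B by (intro sum.cong)
        (auto simp: sym_matrix_inner[OF sym, symmetric] orthonormal_eigenbasis_def power2_eq_square)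
    then show ?thesis
      using convex_on_sum[OF orthonormal_basis_finite(1)[OF onb] _ h weights[OF that], of ev]
        weights[OF that] by fastforce
  qed
  then have "(\<Sum>c\<in>C. h (c \<bullet> (E *v c))) \<le> (\<Sum>c\<in>C. \<Sum>b\<in>B. (b \<bullet> c)\<^sup>2 * h (ev b))"
    by (rule sum_mono)
  also have "\<dots> = (\<Sum>b\<in>B. (\<Sum>c\<in>C. (b \<bullet> c)\<^sup>2) * h (ev b))"
    by (subst sum.swap) (simp add: sum_distrib_right)
  also have "\<dots> = sum_eigenvalues h E"
    by (simp add: weights' sum_eigenvalues_eigenbasis[OF sym B])
  finally show ?thesis .
qed

lemma subspace_sym_matrices: "subspace (sym_matrices :: (real^'m^'m) set)"
  unfolding subspace_def sym_matrices_def transpose_def by (simp add: vec_eq_iff)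

text \<open>In an eigenbasis of the convex combination its eigenvalues are diagonal entries, which are linear
  in the matrix; the diagonals of the two given matrices are then compared with their spectra.\<close>

lemma convex_on_sum_eigenvalues:
  assumes h: "convex_on UNIV h"
  shows "convex_on (sym_matrices :: (real^'m^'m) set) (sum_eigenvalues h)"
  unfolding convex_on_def
proof (intro conjI ballI allI impI)
  show "convex (sym_matrices :: (real^'m^'m) set)"
    by (rule subspace_imp_convex[OF subspace_sym_matrices])
  fix X Y :: "real^'m^'m" and u v :: real
  assume sym: "X \<in> sym_matrices" "Y \<in> sym_matrices" and uv: "0 \<le> u" "0 \<le> v" "u + v = 1"
  define Z where "Z = u *\<^sub>R X + v *\<^sub>R Y"
  have Z: "Z \<in> sym_matrices" unfolding Z_def
    using sym by (simp add: subspace_sym_matrices subspace_add subspace_scale)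
  obtain B ev where B: "orthonormal_eigenbasis Z B ev"
    using orthonormal_eigenbasis_exists[OF Z] .
  then have onb: "orthonormal_basis B" by (simp add: orthonormal_eigenbasis_def)
  have "sum_eigenvalues h Z = (\<Sum>b\<in>B. h (u * (b \<bullet> (X *v b)) + v * (b \<bullet> (Y *v b))))"
    unfolding sum_eigenvalues_eigenbasis[OF Z B]
  proof (intro sum.cong refl)
    fix b assume b: "b \<in> B"
    have "ev b = b \<bullet> (Z *v b)"
      using B b by (auto simp: orthonormal_eigenbasis_def orthonormal_basis_def dot_square_norm)
    then show "h (ev b) = h (u * (b \<bullet> (X *v b)) + v * (b \<bullet> (Y *v b)))"
      by (simp add: Z_def matrix_vector_mult_add_rdistrib inner_simps scaleR_matrix_vector_assoc[symmetric])
  qed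
  also have "\<dots> \<le> (\<Sum>b\<in>B. u * h (b \<bullet> (X *v b)) + v * h (b \<bullet> (Y *v b)))"
    using h uv by (intro sum_mono) (simp add: convex_on_def)
  also have "\<dots> = u * (\<Sum>b\<in>B. h (b \<bullet> (X *v b))) + v * (\<Sum>b\<in>B. h (b \<bullet> (Y *v b)))"
    by (simp add: sum.distrib sum_distrib_left)
  also have "\<dots> \<le> u * sum_eigenvalues h X + v * sum_eigenvalues h Y"
    using sum_diagonal_le_sum_eigenvalues[OF _ h onb] sym uv
    by (intro add_mono mult_left_mono) auto
  finally show "sum_eigenvalues h (u *\<^sub>R X + v *\<^sub>R Y) \<le> u * sum_eigenvalues h X + v * sum_eigenvalues h Y"
    by (simp add: Z_def)
qed

section \<open>Convexity of the energy splits\<close>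

definition sym_part :: "real^'m^'m \<Rightarrow> real^'m^'m" where
  "sym_part E = (1/2) *\<^sub>R (E + transpose E)"

lemma sym_part_in_sym_matrices: "sym_part E \<in> sym_matrices"
  unfolding sym_part_def sym_matrices_def transpose_def by (simp add: vec_eq_iff)

lemma sym_part_sym: "E \<in> sym_matrices \<Longrightarrow> sym_part E = E"
  unfolding sym_part_def sym_matrices_def by (simp add: scaleR_2[symmetric])

lemma linear_sym_part: "linear sym_part"
  by (rule linearI) (simp_all add: sym_part_def transpose_def vec_eq_iff algebra_simps)

lemma convex_on_compose_linear:
  assumes f: "linear f" and g: "convex_on S g" and K: "convex K" "\<And>x. x \<in> K \<Longrightarrow> f x \<in> S"
  shows "convex_on K (\<lambda>x. g (f x))"
  using g K unfolding convex_on_def by (simp add: linear_add[OF f] linear_scale[OF f])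

text \<open>Convex functions are continuous on open sets, but the symmetric matrices have empty interior in the
  space of all matrices. Composition with the symmetric part gives a convex function on
  the whole space.\<close>

lemma continuous_on_convex_sym_part:
  fixes f :: "real^'m^'m \<Rightarrow> real"
  assumes "convex_on sym_matrices f"
  shows "continuous_on S (\<lambda>E. f (sym_part E))"
  using convex_on_continuous[OF open_UNIV
      convex_on_compose_linear[OF linear_sym_part assms convex_UNIV sym_part_in_sym_matrices]]
    continuous_on_subset by blast

lemma convex_on_cong:
  assumes "\<And>x. x \<in> S \<Longrightarrow> f x = g x"
  shows "convex_on S f \<longleftrightarrow> convex_on S g"
  using assms unfolding convex_on_def convex_def by auto

lemma power2_convex_combination:
  fixes a b t :: real
  assumes "0 \<le> t" "t \<le> 1"
  shows "((1 - t) * a + t * b)\<^sup>2 \<le> (1 - t) * a\<^sup>2 + t * b\<^sup>2"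
proof -
  have "(1 - t) * a\<^sup>2 + t * b\<^sup>2 - ((1 - t) * a + t * b)\<^sup>2 = t * (1 - t) * (a - b)\<^sup>2"
    by (simp add: power2_eq_square algebra_simps)
  moreover have "0 \<le> t * (1 - t) * (a - b)\<^sup>2" using assms by simp
  ultimately show ?thesis by linarith
qed

lemma convex_on_power2:
  fixes f :: "'a::real_vector \<Rightarrow> real"
  assumes "convex_on S f" "\<And>x. x \<in> S \<Longrightarrow> 0 \<le> f x"
  shows "convex_on S (\<lambda>x. (f x)\<^sup>2)"
  unfolding convex_on_def
proof (intro conjI ballI allI impI)
  show "convex S" using assms(1) by (simp add: convex_on_def)
  fix x y and u v :: real
  assume *: "x \<in> S" "y \<in> S" "0 \<le> u" "0 \<le> v" "u + v = 1"
  then have "u *\<^sub>R x + v *\<^sub>R y \<in> S"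
    using \<open>convex S\<close> by (simp add: convex_def)
  then have "(f (u *\<^sub>R x + v *\<^sub>R y))\<^sup>2 \<le> (u * f x + v * f y)\<^sup>2"
    using assms * by (intro power_mono) (auto simp: convex_on_def)
  also have "\<dots> \<le> u * (f x)\<^sup>2 + v * (f y)\<^sup>2"
  proof -
    have u: "u = 1 - v" using * by simp
    show ?thesis unfolding u using * by (intro power2_convex_combination) auto
  qed
  finally show "(f (u *\<^sub>R x + v *\<^sub>R y))\<^sup>2 \<le> u * (f x)\<^sup>2 + v * (f y)\<^sup>2" .
qed

lemma convex_on_max_fun:
  fixes f g :: "'a::real_vector \<Rightarrow> real"
  assumes "convex_on S f" "convex_on S g"
  shows "convex_on S (\<lambda>x. max (f x) (g x))"
  unfolding convex_on_def
proof (intro conjI ballI allI impI)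
  show "convex S" using assms(1) by (simp add: convex_on_def)
  fix x y and u v :: real
  assume *: "x \<in> S" "y \<in> S" "0 \<le> u" "0 \<le> v" "u + v = 1"
  have "f (u *\<^sub>R x + v *\<^sub>R y) \<le> u * f x + v * f y" "g (u *\<^sub>R x + v *\<^sub>R y) \<le> u * g x + v * g y"
    using assms * by (auto simp: convex_on_def)
  moreover have "u * f x + v * f y \<le> u * max (f x) (g x) + v * max (f y) (g y)"
    "u * g x + v * g y \<le> u * max (f x) (g x) + v * max (f y) (g y)"
    using * by (intro add_mono mult_left_mono; simp)+
  ultimately show "max (f (u *\<^sub>R x + v *\<^sub>R y)) (g (u *\<^sub>R x + v *\<^sub>R y))
      \<le> u * max (f x) (g x) + v * max (f y) (g y)" by linarith
qed

text \<open>For affine \<open>f\<close> both truncations \<open>max 0 f\<close> and \<open>- min 0 f\<close> are convex and nonnegative, and the square is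
  convex and increasing on nonnegative numbers.\<close>

lemma convex_on_max_zero_power2:
  fixes f :: "'a::real_vector \<Rightarrow> real"
  assumes "convex S" "\<And>x y u v. x \<in> S \<Longrightarrow> y \<in> S \<Longrightarrow> u + v = 1 \<Longrightarrow> f (u *\<^sub>R x + v *\<^sub>R y) = u * f x + v * f y"
  shows "convex_on S (\<lambda>x. (max 0 (f x))\<^sup>2)" and "convex_on S (\<lambda>x. (min 0 (f x))\<^sup>2)"
    and "convex_on S (\<lambda>x. (f x)\<^sup>2)"
proof -
  have aff: "convex_on S f" "convex_on S (\<lambda>x. - f x)"
    using assms by (auto simp: convex_on_def)
  have zero: "convex_on S (\<lambda>x. 0::real)" using assms(1) by (simp add: convex_on_const)
  show 1: "convex_on S (\<lambda>x. (max 0 (f x))\<^sup>2)"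
    using convex_on_max_fun[OF zero aff(1)] by (intro convex_on_power2) auto
  have "convex_on S (\<lambda>x. (max 0 (- f x))\<^sup>2)"
    using convex_on_max_fun[OF zero aff(2)] by (intro convex_on_power2) auto
  moreover have "(max 0 (- f x))\<^sup>2 = (min 0 (f x))\<^sup>2" for x by (auto simp: max_def min_def)
  ultimately show 2: "convex_on S (\<lambda>x. (min 0 (f x))\<^sup>2)" by simp
  have "(f x)\<^sup>2 = (max 0 (f x))\<^sup>2 + (min 0 (f x))\<^sup>2" for x by (auto simp: max_def min_def)
  then show "convex_on S (\<lambda>x. (f x)\<^sup>2)" using convex_on_add[OF 1 2] by simp
qed

lemma convex_sym_matrices: "convex (sym_matrices :: (real^'m^'m) set)"
  by (rule subspace_imp_convex[OF subspace_sym_matrices])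

lemma linear_trace: "linear (trace :: real^'m^'m \<Rightarrow> real)"
  by (rule linearI) (simp_all add: trace_def sum.distrib sum_distrib_left)

lemma linear_dev: "linear (dev :: real^'m^'m \<Rightarrow> real^'m^'m)"
  by (rule linearI)
    (simp_all add: dev_def linear_add[OF linear_trace] linear_scale[OF linear_trace]
      algebra_simps add_divide_distrib)

lemma convex_on_trace:
  shows "convex_on (sym_matrices :: (real^'m^'m) set) (\<lambda>E. (max 0 (trace E))\<^sup>2)"
    and "convex_on (sym_matrices :: (real^'m^'m) set) (\<lambda>E. (min 0 (trace E))\<^sup>2)"
    and "convex_on (sym_matrices :: (real^'m^'m) set) (\<lambda>E. (trace E)\<^sup>2)"
  by (intro convex_on_max_zero_power2 convex_sym_matrices;
      simp add: linear_add[OF linear_trace] linear_scale[OF linear_trace])+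

lemma convex_on_inner_self_linear:
  fixes f :: "'a::real_vector \<Rightarrow> 'b::real_inner"
  assumes "convex S" "linear f"
  shows "convex_on S (\<lambda>x. f x \<bullet> f x)"
proof -
  have "convex_on S (\<lambda>x. norm (f x))"
    unfolding convex_on_def
  proof (intro conjI ballI allI impI \<open>convex S\<close>)
    fix x y and u v :: real assume "0 \<le> u" "0 \<le> v"
    then show "norm (f (u *\<^sub>R x + v *\<^sub>R y)) \<le> u * norm (f x) + v * norm (f y)"
      using norm_triangle_ineq[of "u *\<^sub>R f x" "v *\<^sub>R f y"]
      by (simp add: linear_add[OF assms(2)] linear_scale[OF assms(2)])
  qed
  from convex_on_power2[OF this] show ?thesis by (simp add: power2_norm_eq_inner)
qed

lemma trace_square_sym:
  assumes "E \<in> sym_matrices" shows "trace (E ** E) = E \<bullet> E"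
proof -
  have E: "transpose E = E" using assms by (simp add: sym_matrices_def)
  have "E $ j $ i = transpose E $ i $ j" for i j by (simp add: transpose_def)
  then have "E $ j $ i = E $ i $ j" for i j by (simp only: E)
  then show ?thesis by (simp add: trace_def matrix_matrix_mult_def inner_vec_def)
qed

lemma dev_inner_dev:
  fixes E :: "real^'m^'m"
  shows "dev E \<bullet> dev E = E \<bullet> E - (trace E)\<^sup>2 / real CARD('m)"
proof -
  have 1: "A \<bullet> mat 1 = trace A" for A :: "real^'m^'m"
    by (simp add: inner_vec_def mat_def trace_def if_distrib cong: if_cong)
  show ?thesis
    unfolding dev_def
    by (simp add: inner_diff_right inner_diff_left 1 inner_commute[of "mat 1"] linear_diff[OF linear_trace]
        linear_scale[OF linear_trace] trace_I power2_eq_square)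
qed

lemma psi0_sym:
  assumes "E \<in> sym_matrices" shows "psi0 mu lam E = lam / 2 * (trace E)\<^sup>2 + mu * (E \<bullet> E)"
  by (simp add: psi0_def trace_square_sym[OF assms])

text \<open>Strong convexity is used for the pair \<open>E\<close>, \<open>- E\<close>: the midpoint is \<open>0\<close>, where \<open>psi0\<close> vanishes, and
  \<open>psi0\<close> is even.\<close>

lemma psi0_coercive:
  assumes "strongly_convex_on (sym_matrices :: (real^'m^'m) set) (psi0 mu lam)"
  obtains c where "c > 0" "\<And>E. E \<in> (sym_matrices :: (real^'m^'m) set) \<Longrightarrow> c * (norm E)\<^sup>2 \<le> psi0 mu lam E"
proof -
  obtain c where c: "c > 0" and sc: "\<forall>x\<in>(sym_matrices :: (real^'m^'m) set). \<forall>y\<in>sym_matrices. \<forall>t\<in>{0..1}.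
      psi0 mu lam ((1 - t) *\<^sub>R x + t *\<^sub>R y)
       \<le> (1 - t) * psi0 mu lam x + t * psi0 mu lam y - c / 2 * t * (1 - t) * (norm (x - y))\<^sup>2"
    using assms unfolding strongly_convex_on_def by blast
  have "c / 2 * (norm E)\<^sup>2 \<le> psi0 mu lam E" if E: "E \<in> sym_matrices" for E :: "real^'m^'m"
  proof -
    have mE: "- E \<in> sym_matrices" using subspace_neg[OF subspace_sym_matrices E] .
    have 0: "psi0 mu lam (0 :: real^'m^'m) = 0" by (simp add: psi0_def trace_def matrix_matrix_mult_def)
    have m: "psi0 mu lam (- E) = psi0 mu lam E"
      by (simp add: psi0_sym E mE linear_neg[OF linear_trace])
    have "psi0 mu lam ((1 - 1/2) *\<^sub>R E + (1/2) *\<^sub>R (- E))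
       \<le> (1 - 1/2) * psi0 mu lam E + 1/2 * psi0 mu lam (- E) - c / 2 * (1/2) * (1 - 1/2) * (norm (E - - E))\<^sup>2"
      by (rule sc[rule_format, OF E mE]) simp
    moreover have "norm (E - - E) = 2 * norm E"
      by (simp add: scaleR_2[symmetric])
    ultimately show ?thesis by (simp add: 0 m power2_eq_square)
  qed
  with c show ?thesis by (intro that[of "c / 2"]) auto
qed

lemma psi0_convex:
  assumes "strongly_convex_on (sym_matrices :: (real^'m^'m) set) (psi0 mu lam)"
  shows "convex_on (sym_matrices :: (real^'m^'m) set) (psi0 mu lam)"
proof -
  obtain c where c: "c > 0" and sc: "\<forall>x\<in>(sym_matrices :: (real^'m^'m) set). \<forall>y\<in>sym_matrices. \<forall>t\<in>{0..1}.
      psi0 mu lam ((1 - t) *\<^sub>R x + t *\<^sub>R y)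
       \<le> (1 - t) * psi0 mu lam x + t * psi0 mu lam y - c / 2 * t * (1 - t) * (norm (x - y))\<^sup>2"
    using assms unfolding strongly_convex_on_def by blast
  show ?thesis
  proof (rule convex_onI)
    show "convex (sym_matrices :: (real^'m^'m) set)" by (rule convex_sym_matrices)
    fix t :: real and x y :: "real^'m^'m"
    assume *: "0 < t" "t < 1" "x \<in> sym_matrices" "y \<in> sym_matrices"
    have "0 \<le> c / 2 * t * (1 - t) * (norm (x - y))\<^sup>2" using c * by simp
    with sc[rule_format, of x y t] *
    show "psi0 mu lam ((1 - t) *\<^sub>R x + t *\<^sub>R y) \<le> (1 - t) * psi0 mu lam x + t * psi0 mu lam y"
      by simp
  qed
qed

text \<open>On the identity matrix \<open>psi0\<close> is a positive multiple of this modulus.\<close>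

lemma bulk_modulus_pos:
  assumes "strongly_convex_on (sym_matrices :: (real^'m^'m) set) (psi0 mu lam)"
  shows "mu / real CARD('m) + lam / 2 > 0"
proof -
  obtain c where c: "c > 0" "\<And>E. E \<in> (sym_matrices :: (real^'m^'m) set) \<Longrightarrow> c * (norm E)\<^sup>2 \<le> psi0 mu lam E"
    using psi0_coercive[OF assms] by blast
  let ?I = "mat 1 :: real^'m^'m"
  let ?m = "real CARD('m)"
  have I: "?I \<in> sym_matrices" by (simp add: sym_matrices_def)
  have n: "?I \<bullet> ?I = ?m" using trace_square_sym[OF I] by (simp add: trace_I)
  have "0 < c * (norm ?I)\<^sup>2" using c(1) n by (simp add: power2_norm_eq_inner)
  also have "\<dots> \<le> psi0 mu lam ?I" by (rule c(2)[OF I])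
  also have "\<dots> = ?m\<^sup>2 * (mu / ?m + lam / 2)"
    by (simp add: psi0_sym[OF I] n trace_I power2_eq_square field_simps)
  finally show ?thesis by (simp add: zero_less_mult_iff)
qed

text \<open>What the rest of the proof uses of the material law; the four splits are distinguished only here.
  The sum formula rests on \<open>(max 0 t)\<^sup>2 + (min 0 t)\<^sup>2 = t\<^sup>2\<close> and on the orthogonality of the volumetric
  and deviatoric parts.\<close>

lemma energy_split_properties:
  fixes \<psi>p \<psi>m :: "real^'m^'m \<Rightarrow> real"
  assumes mu: "mu > 0" and sc: "strongly_convex_on (sym_matrices :: (real^'m^'m) set) (psi0 mu lam)"
    and split: "energy_split mu lam \<psi>p \<psi>m"
  shows "convex_on sym_matrices \<psi>p" "convex_on sym_matrices \<psi>m"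
    and "\<And>E. E \<in> sym_matrices \<Longrightarrow> \<psi>p E \<ge> 0" "\<And>E. E \<in> sym_matrices \<Longrightarrow> \<psi>m E \<ge> 0"
    and "\<And>E. E \<in> sym_matrices \<Longrightarrow> \<psi>p E + \<psi>m E = psi0 mu lam E"
proof -
  let ?S = "sym_matrices :: (real^'m^'m) set"
  let ?K = "mu / real CARD('m) + lam / 2"
  have K: "?K > 0" by (rule bulk_modulus_pos[OF sc])
  have dev: "convex_on ?S (\<lambda>E. dev E \<bullet> dev E)"
    by (rule convex_on_inner_self_linear[OF convex_sym_matrices linear_dev])
  have zero: "convex_on ?S (\<lambda>E. 0)" using convex_sym_matrices by (simp add: convex_on_const)
  have vol_dev: "?K * (trace E)\<^sup>2 + mu * (dev E \<bullet> dev E) = psi0 mu lam E" if "E \<in> ?S" for E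
    by (simp add: psi0_sym[OF that] dev_inner_dev algebra_simps)
  have maxmin: "(max 0 t)\<^sup>2 + (min 0 t)\<^sup>2 = t\<^sup>2" for t :: real by (auto simp: max_def min_def)
  have "convex_on ?S \<psi>p \<and> convex_on ?S \<psi>m \<and>
    (\<forall>E\<in>?S. \<psi>p E \<ge> 0 \<and> \<psi>m E \<ge> 0 \<and> \<psi>p E + \<psi>m E = psi0 mu lam E)"
    using split unfolding energy_split_def
  proof (elim disjE)
    assume "split_a mu lam \<psi>p \<psi>m"
    then have eq: "\<psi>p E = psi0 mu lam E" "\<psi>m E = 0" if "E \<in> ?S" for E
      using that by (auto simp: split_a_def)
    obtain c where c: "c > 0" "\<And>E. E \<in> ?S \<Longrightarrow> c * (norm E)\<^sup>2 \<le> psi0 mu lam E"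
      using psi0_coercive[OF sc] by blast
    have "0 \<le> psi0 mu lam E" if "E \<in> ?S" for E
      using c(1) by (intro order_trans[OF _ c(2)[OF that]]) simp
    then show ?thesis
      using psi0_convex[OF sc] zero eq by (simp cong: convex_on_cong)
  next
    assume "split_b mu lam \<psi>p \<psi>m"
    then have eq: "\<psi>p E = ?K * (trace E)\<^sup>2" "\<psi>m E = mu * (dev E \<bullet> dev E)" if "E \<in> ?S" for E
      using that by (auto simp: split_b_def)
    have "convex_on ?S (\<lambda>E. ?K * (trace E)\<^sup>2)" "convex_on ?S (\<lambda>E. mu * (dev E \<bullet> dev E))"
      using K mu by (intro convex_on_cmul convex_on_trace dev; simp)+
    then show ?thesis using eq vol_dev K mu by (simp cong: convex_on_cong)
  next
    assume "split_c mu lam \<psi>p \<psi>m"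
    then have eq: "\<psi>p E = ?K * (max 0 (trace E))\<^sup>2"
      "\<psi>m E = ?K * (min 0 (trace E))\<^sup>2 + mu * (dev E \<bullet> dev E)" if "E \<in> ?S" for E
      using that by (auto simp: split_c_def)
    have cv: "convex_on ?S (\<lambda>E. ?K * (max 0 (trace E))\<^sup>2)"
      "convex_on ?S (\<lambda>E. ?K * (min 0 (trace E))\<^sup>2 + mu * (dev E \<bullet> dev E))"
      using K mu by (intro convex_on_add convex_on_cmul convex_on_trace dev; simp)+
    have "\<psi>p E + \<psi>m E = ?K * (trace E)\<^sup>2 + mu * (dev E \<bullet> dev E)" if "E \<in> ?S" for E
      unfolding eq[OF that] maxmin[symmetric, of "trace E"] by (simp add: algebra_simps)
    then have "\<psi>p E + \<psi>m E = psi0 mu lam E" if "E \<in> ?S" for E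
      using vol_dev that by simp
    then show ?thesis using eq K mu cv by (simp cong: convex_on_cong)
  next
    assume d: "split_d mu lam \<psi>p \<psi>m"
    then have lam: "lam \<ge> 0" by (simp add: split_d_def)
    have eq: "\<psi>p E = lam / 2 * (max 0 (trace E))\<^sup>2 + mu * sum_eigenvalues (\<lambda>t. (max 0 t)\<^sup>2) E"
      "\<psi>m E = lam / 2 * (min 0 (trace E))\<^sup>2 + mu * sum_eigenvalues (\<lambda>t. (min 0 t)\<^sup>2) E" if "E \<in> ?S" for E
      using that d by (auto simp: split_d_def sum_eigenvalues_id)
    have h: "convex_on UNIV (\<lambda>t. (max 0 t)\<^sup>2 :: real)" "convex_on UNIV (\<lambda>t. (min 0 t)\<^sup>2 :: real)"
      by (intro convex_on_max_zero_power2; simp)+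
    have cv: "convex_on ?S (\<lambda>E. lam / 2 * (max 0 (trace E))\<^sup>2 + mu * sum_eigenvalues (\<lambda>t. (max 0 t)\<^sup>2) E)"
      "convex_on ?S (\<lambda>E. lam / 2 * (min 0 (trace E))\<^sup>2 + mu * sum_eigenvalues (\<lambda>t. (min 0 t)\<^sup>2) E)"
      using lam mu h by (intro convex_on_add convex_on_cmul convex_on_trace convex_on_sum_eigenvalues; simp)+
    have "sum_eigenvalues (\<lambda>t. (max 0 t)\<^sup>2) E + sum_eigenvalues (\<lambda>t. (min 0 t)\<^sup>2) E
        = sum_eigenvalues (\<lambda>t. (max 0 t)\<^sup>2 + (min 0 t)\<^sup>2) E" for E :: "real^'m^'m"
      by (simp add: sum_eigenvalues_def sum.distrib distrib_left)
    then have spectral: "sum_eigenvalues (\<lambda>t. (max 0 t)\<^sup>2) E + sum_eigenvalues (\<lambda>t. (min 0 t)\<^sup>2) E = trace (E ** E)"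
      if "E \<in> ?S" for E
      using sum_eigenvalues_square[OF that] by (simp add: maxmin)
    have "\<psi>p E + \<psi>m E = psi0 mu lam E" if "E \<in> ?S" for E
    proof -
      have "\<psi>p E + \<psi>m E = lam / 2 * ((max 0 (trace E))\<^sup>2 + (min 0 (trace E))\<^sup>2)
          + mu * (sum_eigenvalues (\<lambda>t. (max 0 t)\<^sup>2) E + sum_eigenvalues (\<lambda>t. (min 0 t)\<^sup>2) E)"
        unfolding eq[OF that] by (simp only: distrib_left add_ac)
      then show ?thesis unfolding maxmin spectral[OF that] psi0_def .
    qed
    moreover have "\<psi>p E \<ge> 0" "\<psi>m E \<ge> 0" if "E \<in> ?S" for E
      unfolding eq[OF that] using lam mu by (auto intro!: add_nonneg_nonneg mult_nonneg_nonneg sum_eigenvalues_nonneg)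
    ultimately show ?thesis using eq cv by (simp cong: convex_on_cong)
  qed
  then show "convex_on ?S \<psi>p" "convex_on ?S \<psi>m" "\<And>E. E \<in> ?S \<Longrightarrow> \<psi>p E \<ge> 0"
    "\<And>E. E \<in> ?S \<Longrightarrow> \<psi>m E \<ge> 0" "\<And>E. E \<in> ?S \<Longrightarrow> \<psi>p E + \<psi>m E = psi0 mu lam E"
    by auto
qed

section \<open>Shape functions on the reference cell\<close>

definition set_coord :: "'m \<Rightarrow> real \<Rightarrow> real^'m \<Rightarrow> real^'m" where
  "set_coord i a x = (\<chi> j. if j = i then a else x $ j)"

lemma blockwise_affine_coordinate:
  fixes f :: "real^'m \<Rightarrow> 'b::real_vector"
  assumes B: "partition_on UNIV \<B>" and f: "blockwise_affine \<B> f"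
  shows "f x = (1 - x $ i) *\<^sub>R f (set_coord i 0 x) + x $ i *\<^sub>R f (set_coord i 1 x)"
proof -
  obtain b where b: "b \<in> \<B>" "i \<in> b" using B by (metis UNIV_I Union_iff partition_onD1)
  have "(1 - x $ i) *\<^sub>R set_coord i 0 x + x $ i *\<^sub>R set_coord i 1 x = x"
    by (simp add: vec_eq_iff set_coord_def algebra_simps)
  moreover have "\<forall>j. j \<notin> b \<longrightarrow> set_coord i 0 x $ j = set_coord i 1 x $ j"
    using b by (auto simp: set_coord_def)
  ultimately show ?thesis
    using f b(1) unfolding blockwise_affine_def by (metis (no_types, lifting))
qed

text \<open>Continuity of the derivative is required in each fixed direction, which in finite dimensions is
  the same as continuity in the operator norm.\<close>

definition C1_fun :: "(real^'m \<Rightarrow> 'b::real_normed_vector) \<Rightarrow> bool" where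
  "C1_fun f \<longleftrightarrow> (\<exists>D. (\<forall>x. (f has_derivative D x) (at x)) \<and> (\<forall>h. continuous_on UNIV (\<lambda>x. D x h)))"

text \<open>A function that is affine in each coordinate is a polynomial. Here \<open>T\<close> is the set of coordinates on
  which it may depend; each step of the induction writes \<open>f\<close> as an interpolation between two such functions that
  are independent of one more coordinate.\<close>

lemma C1_fun_multiaffine_aux:
  fixes f :: "real^'m \<Rightarrow> 'b::real_normed_vector"
  assumes "finite T"
    and "\<And>x i. f x = (1 - x $ i) *\<^sub>R f (set_coord i 0 x) + x $ i *\<^sub>R f (set_coord i 1 x)"
    and "\<And>x y. (\<forall>i\<in>T. x $ i = y $ i) \<Longrightarrow> f x = f y"
  shows "C1_fun f"
  using assms
proof (induction T arbitrary: f rule: finite_induct)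
  case empty
  have "f = (\<lambda>x. f 0)" by (rule ext, rule empty.prems(2)) simp
  moreover have "C1_fun (\<lambda>x::real^'m. f 0)"
    unfolding C1_fun_def by (intro exI[of _ "\<lambda>x h. 0"]) (auto intro!: derivative_eq_intros)
  ultimately show ?case by metis
next
  case (insert k T)
  have step: "C1_fun (\<lambda>x. f (set_coord k a x))" for a
  proof (rule insert.IH)
    fix x i
    show "f (set_coord k a x) = (1 - x $ i) *\<^sub>R f (set_coord k a (set_coord i 0 x))
        + x $ i *\<^sub>R f (set_coord k a (set_coord i 1 x))"
    proof (cases "i = k")
      case True
      have "set_coord k a (set_coord k b x) = set_coord k a x" for b
        by (simp add: set_coord_def vec_eq_iff)
      then show ?thesis using True by (simp add: scaleR_left_distrib[symmetric])
    next
      case False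
      have "set_coord k a (set_coord i b x) = set_coord i b (set_coord k a x)" for b
        using False by (simp add: set_coord_def vec_eq_iff)
      moreover have "set_coord k a x $ i = x $ i" using False by (simp add: set_coord_def)
      ultimately show ?thesis using insert.prems(1)[of "set_coord k a x" i] by simp
    qed
  next
    fix x y :: "real^'m" assume "\<forall>i\<in>T. x $ i = y $ i"
    then show "f (set_coord k a x) = f (set_coord k a y)"
      by (intro insert.prems(2)) (auto simp: set_coord_def)
  qed
  obtain D0 where D0: "\<And>x. ((\<lambda>x. f (set_coord k 0 x)) has_derivative D0 x) (at x)"
    "\<And>h. continuous_on UNIV (\<lambda>x. D0 x h)"
    using step[of 0] unfolding C1_fun_def by blast
  obtain D1 where D1: "\<And>x. ((\<lambda>x. f (set_coord k 1 x)) has_derivative D1 x) (at x)"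
    "\<And>h. continuous_on UNIV (\<lambda>x. D1 x h)"
    using step[of 1] unfolding C1_fun_def by blast
  have cont: "continuous_on UNIV (\<lambda>x. f (set_coord k 0 x))" "continuous_on UNIV (\<lambda>x. f (set_coord k 1 x))"
    using D0(1) D1(1) by (meson continuous_at_imp_continuous_on has_derivative_continuous)+
  let ?D = "\<lambda>x h. ((1 - x $ k) *\<^sub>R D0 x h - (h $ k) *\<^sub>R f (set_coord k 0 x))
      + (x $ k *\<^sub>R D1 x h + (h $ k) *\<^sub>R f (set_coord k 1 x))"
  have "((\<lambda>x. (1 - x $ k) *\<^sub>R f (set_coord k 0 x) + x $ k *\<^sub>R f (set_coord k 1 x))
     has_derivative ?D x) (at x)" for x
    by (rule derivative_eq_intros D0(1) D1(1) bounded_linear_vec_nth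
        bounded_linear.has_derivative[OF bounded_linear_vec_nth] refl | simp)+
  moreover have "(\<lambda>x. (1 - x $ k) *\<^sub>R f (set_coord k 0 x) + x $ k *\<^sub>R f (set_coord k 1 x)) = f"
    using insert.prems(1)[symmetric, of _ k] by auto
  ultimately have "(f has_derivative ?D x) (at x)" for x by simp
  moreover have "continuous_on UNIV (\<lambda>x. ?D x h)" for h
    by (intro continuous_intros cont D0(2) D1(2))
  ultimately show ?case unfolding C1_fun_def by (intro exI[of _ ?D]) blast
qed

lemma C1_fun_blockwise_affine:
  fixes f :: "real^'m \<Rightarrow> 'b::real_normed_vector"
  assumes "partition_on UNIV \<B>" "blockwise_affine \<B> f"
  shows "C1_fun f"
  by (rule C1_fun_multiaffine_aux[OF finite[of UNIV] blockwise_affine_coordinate[OF assms]])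
    (simp add: vec_eq_iff[symmetric])

lemma ref_cell_unit_interval:
  assumes B: "partition_on UNIV \<B>" and x: "x \<in> ref_cell \<B>"
  shows "0 \<le> x $ i" "x $ i \<le> 1"
proof -
  show "0 \<le> x $ i" using x by (simp add: ref_cell_def)
  obtain b where b: "b \<in> \<B>" "i \<in> b" using B by (metis UNIV_I Union_iff partition_onD1)
  have "x $ i \<le> (\<Sum>j\<in>b. x $ j)"
    using x b(2) by (intro member_le_sum) (auto simp: ref_cell_def)
  also have "\<dots> \<le> 1" using x b(1) by (simp add: ref_cell_def)
  finally show "x $ i \<le> 1" .
qed

lemma compact_ref_cell:
  assumes "partition_on UNIV \<B>" shows "compact (ref_cell \<B>)"
proof -
  have "ref_cell \<B> = (\<Inter>i. {x. 0 \<le> x $ i}) \<inter> (\<Inter>b\<in>\<B>. {x. (\<Sum>i\<in>b. x $ i) \<le> 1})"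
    by (auto simp: ref_cell_def)
  moreover have "closed \<dots>"
    by (intro closed_Int closed_INT ballI closed_Collect_le continuous_intros)
  moreover have "bounded (ref_cell \<B>)"
    using ref_cell_unit_interval[OF assms]
    by (intro bounded_subset[OF bounded_cbox[of 0 "1::real^_"]]) (auto simp: mem_box_cart)
  ultimately show ?thesis by (simp add: compact_eq_bounded_closed)
qed

text \<open>Points with all coordinates between \<open>0\<close> and \<open>1 / m\<close> satisfy the constraint of every block.\<close>

lemma interior_ref_cell_nonempty:
  shows "interior (ref_cell \<B> :: (real^'m) set) \<noteq> {}"
proof -
  let ?m = "real CARD('m)"
  let ?U = "{x :: real^'m. \<forall>i. 0 < x $ i \<and> x $ i < 1 / ?m}"
  have "?U = (\<Inter>i. {x. 0 < x $ i} \<inter> {x. x $ i < 1 / ?m})" by auto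
  moreover have "open \<dots>"
    by (intro open_INT finite ballI open_Int open_Collect_less continuous_intros)
  ultimately have "open ?U" by simp
  moreover have "?U \<subseteq> ref_cell \<B>"
  proof
    fix x assume x: "x \<in> ?U"
    have "(\<Sum>i\<in>b. x $ i) \<le> 1" for b
    proof -
      have "(\<Sum>i\<in>b. x $ i) \<le> (\<Sum>i\<in>b. 1 / ?m)" using x by (intro sum_mono) (auto intro: less_imp_le)
      also have "\<dots> = real (card b) / ?m" by simp
      also have "\<dots> \<le> 1" by (simp add: card_mono)
      finally show ?thesis .
    qed
    then show "x \<in> ref_cell \<B>" using x by (auto simp: ref_cell_def intro: less_imp_le)
  qed
  moreover have "(\<chi> i. 1 / (2 * ?m)) \<in> ?U" by (simp add: divide_simps)
  ultimately show ?thesis using interior_maximal by blast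
qed

lemma integral_point_vertex_ref_cell:
  assumes B: "partition_on UNIV \<B>" and x: "x \<in> ref_cell \<B>" "\<And>i. x $ i = 0 \<or> x $ i = 1"
  shows "x \<in> vertices (ref_cell \<B>)"
proof -
  have "x \<notin> open_segment a b" if a: "a \<in> ref_cell \<B>" and b: "b \<in> ref_cell \<B>" for a b
  proof
    assume "x \<in> open_segment a b"
    then obtain u where u: "a \<noteq> b" "0 < u" "u < 1" and xu: "x = (1 - u) *\<^sub>R a + u *\<^sub>R b"
      by (auto simp: in_segment)
    have "a $ i = b $ i" for i
    proof -
      note ab = ref_cell_unit_interval[OF B a, of i] ref_cell_unit_interval[OF B b, of i]
      have eq: "x $ i = (1 - u) * a $ i + u * b $ i" by (simp add: xu)
      from x(2)[of i] show ?thesis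
      proof
        assume "x $ i = 0"
        then have "(1 - u) * a $ i = 0 \<and> u * b $ i = 0"
          using ab u eq by (smt (verit) mult_nonneg_nonneg)
        then show ?thesis using u by simp
      next
        assume "x $ i = 1"
        then have "(1 - u) * (1 - a $ i) + u * (1 - b $ i) = 0"
          using eq by (simp add: algebra_simps)
        moreover have "0 \<le> (1 - u) * (1 - a $ i)" "0 \<le> u * (1 - b $ i)" using ab u by simp_all
        ultimately have "(1 - u) * (1 - a $ i) = 0 \<and> u * (1 - b $ i) = 0" by linarith
        then show ?thesis using u by simp
      qed
    qed
    then show False using u(1) by (simp add: vec_eq_iff)
  qed
  then show ?thesis using x(1) by (simp add: vertices_def extreme_point_of_def)
qed

text \<open>Minimum principle for shape functions. A point of the cell with a fractional coordinate \<open>i\<close> is a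
  convex combination of two points of the cell with fewer fractional coordinates: if the block of \<open>i\<close> has
  a second fractional coordinate \<open>j\<close>, mass is shifted between \<open>i\<close> and \<open>j\<close> until one of them vanishes;
  otherwise the remaining coordinates of the block are zero and \<open>i\<close> may be set to \<open>0\<close> or \<open>1\<close>.
  Both points differ only within the block, along which \<open>w\<close> is affine. Points without fractional
  coordinates are vertices.\<close>

lemma blockwise_affine_nonneg:
  fixes w :: "real^'m \<Rightarrow> real"
  assumes B: "partition_on UNIV \<B>" and w: "blockwise_affine \<B> w"
    and vert: "\<And>v. v \<in> vertices (ref_cell \<B>) \<Longrightarrow> 0 \<le> w v"
    and x: "x \<in> ref_cell \<B>"
  shows "0 \<le> w x"
  using x
proof (induction "card {i. 0 < x $ i \<and> x $ i < 1}" arbitrary: x rule: less_induct)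
  case less
  let ?Fr = "\<lambda>x :: real^'m. {i. 0 < x $ i \<and> x $ i < 1}"
  note x = less.prems
  note box = ref_cell_unit_interval[OF B x]
  show ?case
  proof (cases "?Fr x = {}")
    case True
    have "x $ i = 0 \<or> x $ i = 1" for i
    proof -
      have "\<not> (0 < x $ i \<and> x $ i < 1)" using True by blast
      then show ?thesis using box[of i] by linarith
    qed
    then show ?thesis using vert integral_point_vertex_ref_cell[OF B x] by blast
  next
    case False
    then obtain i where i: "0 < x $ i" "x $ i < 1" by blast
    obtain b where b: "b \<in> \<B>" "i \<in> b" using B by (metis UNIV_I Union_iff partition_onD1)
    have uniq: "b' = b" if "b' \<in> \<B>" "j \<in> b'" "j \<in> b" for b' j
      using B b(1) that by (auto simp: partition_on_def disjoint_def)
    have combine: "0 \<le> w x"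
      if yz: "y \<in> ref_cell \<B>" "z \<in> ref_cell \<B>" "?Fr y \<subset> ?Fr x" "?Fr z \<subset> ?Fr x"
        and agree: "\<forall>j. j \<notin> b \<longrightarrow> y $ j = z $ j"
        and t: "0 \<le> t" "t \<le> 1" "x = (1 - t) *\<^sub>R y + t *\<^sub>R z" for y z t
    proof -
      have "0 \<le> w y" "0 \<le> w z"
        using less.hyps yz by (simp_all add: psubset_card_mono)
      moreover have "w x = (1 - t) * w y + t * w z"
        using w b(1) agree t(3) unfolding blockwise_affine_def by simp
      ultimately show ?thesis using t by simp
    qed
    show ?thesis
    proof (cases "\<exists>j\<in>b. j \<noteq> i \<and> 0 < x $ j \<and> x $ j < 1")
      case True
      then obtain j where j: "j \<in> b" "j \<noteq> i" "0 < x $ j" "x $ j < 1" by blast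
      define s where "s = x $ i + x $ j"
      have "s = (\<Sum>k\<in>{i, j}. x $ k)" using j(2) by (simp add: s_def)
      also have "\<dots> \<le> (\<Sum>k\<in>b. x $ k)" using b(2) j(1) box by (intro sum_mono2) auto
      also have "\<dots> \<le> 1" using x b(1) by (simp add: ref_cell_def)
      finally have s: "0 < s" "s \<le> 1" using i j by (simp_all add: s_def)
      define sh where "sh r = x + r *\<^sub>R (axis i 1 - axis j 1 :: real^'m)" for r
      have sh_nth: "sh r $ k = (if k = i then x $ i + r else if k = j then x $ j - r else x $ k)" for r k
        using j(2) by (simp add: sh_def axis_def)
      have sum: "(\<Sum>k\<in>b'. sh r $ k) \<le> 1" if b': "b' \<in> \<B>" for b' r
      proof -
        have "(\<Sum>k\<in>b'. sh r $ k) = (\<Sum>k\<in>b'. x $ k) + r * ((\<Sum>k\<in>b'. (axis i 1 :: real^'m) $ k)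
            - (\<Sum>k\<in>b'. (axis j 1 :: real^'m) $ k))"
          by (simp add: sh_def sum.distrib sum_subtractf sum_distrib_left right_diff_distrib)
        also have "(\<Sum>k\<in>b'. (axis i 1 :: real^'m) $ k) = (\<Sum>k\<in>b'. (axis j 1 :: real^'m) $ k)"
          using uniq[OF b' _ b(2)] uniq[OF b' _ j(1)] b(2) j(1) by (auto simp: axis_def)
        finally show ?thesis using x b' by (simp add: ref_cell_def)
      qed
      show ?thesis
      proof (rule combine[of "sh (x $ j)" "sh (- (x $ i))" "x $ j / s"])
        show "sh (x $ j) \<in> ref_cell \<B>" "sh (- (x $ i)) \<in> ref_cell \<B>"
          using sum box i j by (auto simp: ref_cell_def sh_nth)
        have "?Fr (sh (x $ j)) \<subseteq> ?Fr x - {j}" "?Fr (sh (- (x $ i))) \<subseteq> ?Fr x - {i}"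
          using i j by (auto simp: sh_nth split: if_splits)
        then show "?Fr (sh (x $ j)) \<subset> ?Fr x" "?Fr (sh (- (x $ i))) \<subset> ?Fr x" using i j by auto
        show "\<forall>k. k \<notin> b \<longrightarrow> sh (x $ j) $ k = sh (- (x $ i)) $ k"
          using b(2) j(1) by (auto simp: sh_nth)
        show "0 \<le> x $ j / s" "x $ j / s \<le> 1" using i j by (simp_all add: s_def)
        have "(1 - x $ j / s) * x $ j = x $ j / s * x $ i"
          using s by (simp add: field_simps s_def)
        moreover have "(1 - t) *\<^sub>R sh (x $ j) + t *\<^sub>R sh (- (x $ i))
            = x + ((1 - t) * x $ j - t * x $ i) *\<^sub>R (axis i 1 - axis j 1)" for t
          unfolding sh_def by (simp add: algebra_simps)
        ultimately show "x = (1 - x $ j / s) *\<^sub>R sh (x $ j) + (x $ j / s) *\<^sub>R sh (- (x $ i))"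
          by simp
      qed
    next
      case False
      then have others: "x $ j = 0 \<or> x $ j = 1" if "j \<in> b" "j \<noteq> i" for j
        using that box[of j] by (metis less_eq_real_def)
      have others0: "x $ j = 0" if j: "j \<in> b" "j \<noteq> i" for j
      proof -
        have "x $ i + x $ j = (\<Sum>k\<in>{i, j}. x $ k)" using j(2) by simp
        also have "\<dots> \<le> (\<Sum>k\<in>b. x $ k)" using b(2) j(1) box by (intro sum_mono2) auto
        also have "\<dots> \<le> 1" using x b(1) by (simp add: ref_cell_def)
        finally show ?thesis using others[OF j] i by auto
      qed
      have in_cell: "set_coord i a x \<in> ref_cell \<B>" if a: "0 \<le> a" "a \<le> 1" for a
      proof -
        have "(\<Sum>k\<in>b'. set_coord i a x $ k) \<le> 1" if b': "b' \<in> \<B>" for b'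
        proof (cases "b' = b")
          case True
          have "(\<Sum>k\<in>b. set_coord i a x $ k) = (\<Sum>k\<in>b. if k = i then a else 0)"
            by (intro sum.cong refl) (auto simp: set_coord_def others0)
          then show ?thesis using True b(2) a by simp
        next
          case False
          then have "(\<Sum>k\<in>b'. set_coord i a x $ k) = (\<Sum>k\<in>b'. x $ k)"
            using uniq[OF b' _ b(2)] by (intro sum.cong refl) (auto simp: set_coord_def)
          then show ?thesis using x b' by (simp add: ref_cell_def)
        qed
        then show ?thesis using a box by (simp add: ref_cell_def set_coord_def)
      qed
      show ?thesis
      proof (rule combine[of "set_coord i 0 x" "set_coord i 1 x" "x $ i"])
        have "?Fr (set_coord i a x) \<subseteq> ?Fr x - {i}" if "a = 0 \<or> a = 1" for a
          using that by (auto simp: set_coord_def split: if_splits)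
        then show "?Fr (set_coord i 0 x) \<subset> ?Fr x" "?Fr (set_coord i 1 x) \<subset> ?Fr x"
          using i by blast+
        show "x = (1 - x $ i) *\<^sub>R set_coord i 0 x + x $ i *\<^sub>R set_coord i 1 x"
          by (simp add: vec_eq_iff set_coord_def algebra_simps)
      qed (use in_cell b(2) i in \<open>auto simp: set_coord_def\<close>)
    qed
  qed
qed

section \<open>Gradients of finite element functions\<close>

lemma derivative_on_segment:
  fixes f :: "'a::real_normed_vector \<Rightarrow> 'b::real_normed_vector"
  assumes S: "convex S" "x \<in> S" "y \<in> S" and t: "t \<in> {0..1}"
    and f: "(f has_derivative L) (at (x + t *\<^sub>R (y - x)) within S)"
  shows "((\<lambda>t. f (x + t *\<^sub>R (y - x))) has_vector_derivative L (y - x)) (at t within {0..1})"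
proof -
  let ?p = "\<lambda>t. x + t *\<^sub>R (y - x)"
  have "?p s \<in> S" if "s \<in> {0..1}" for s
  proof -
    have "?p s = (1 - s) *\<^sub>R x + s *\<^sub>R y" by (simp add: algebra_simps)
    then show ?thesis using convexD_alt[OF S, of s] that by simp
  qed
  then have sub: "?p ` {0..1} \<subseteq> S" by auto
  have p: "(?p has_derivative (\<lambda>s. s *\<^sub>R (y - x))) (at t within {0..1})"
    by (auto intro!: derivative_eq_intros)
  interpret L: bounded_linear L using f by (rule has_derivative_bounded_linear)
  show ?thesis
    using has_derivative_in_compose[OF p has_derivative_subset[OF f sub]]
    by (simp add: has_vector_derivative_def L.scaleR)
qed

text \<open>At a boundary point of \<open>S\<close> the coordinate directions may leave \<open>S\<close>. The derivative is determined along
  the segments from \<open>x\<close> to the points of \<open>S\<close> instead, and their directions span the space as \<open>S\<close>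
  has interior points.\<close>

lemma derivative_unique_within_convex:
  fixes f :: "'a::real_normed_vector \<Rightarrow> 'b::real_normed_vector"
  assumes S: "convex S" "interior S \<noteq> {}" "x \<in> S"
    and L: "(f has_derivative L) (at x within S)" and L': "(f has_derivative L') (at x within S)"
  shows "L = L'"
proof
  fix h :: 'a
  interpret L: bounded_linear L using L by (rule has_derivative_bounded_linear)
  interpret L': bounded_linear L' using L' by (rule has_derivative_bounded_linear)
  have eq: "L (z - x) = L' (z - x)" if "z \<in> S" for z
  proof (rule vector_derivative_unique_within)
    show "at (0::real) within {0..1} \<noteq> bot"
      by (simp add: at_within_Icc_at_right)
    show "((\<lambda>t. f (x + t *\<^sub>R (z - x))) has_vector_derivative L (z - x)) (at 0 within {0..1})"
      "((\<lambda>t. f (x + t *\<^sub>R (z - x))) has_vector_derivative L' (z - x)) (at 0 within {0..1})"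
      using L L' by (intro derivative_on_segment S(1,3) that; simp)+
  qed
  obtain c where "c \<in> interior S" using S(2) by blast
  then obtain r where r: "r > 0" "cball c r \<subseteq> S" by (auto simp: mem_interior_cball)
  define s where "s = r / (norm h + 1)"
  have s: "s > 0" using r by (simp add: s_def add_nonneg_pos)
  have "norm (s *\<^sub>R h) \<le> r"
    using r by (simp add: s_def divide_simps mult_left_mono add_nonneg_pos)
  then have "c + s *\<^sub>R h \<in> S" "c \<in> S" using r by (auto simp: dist_norm subset_iff)
  then have "L ((c + s *\<^sub>R h - x) - (c - x)) = L' ((c + s *\<^sub>R h - x) - (c - x))"
    unfolding L.diff[of "c + s *\<^sub>R h - x"] L'.diff[of "c + s *\<^sub>R h - x"] by (simp only: eq)
  then have "L (s *\<^sub>R h) = L' (s *\<^sub>R h)" by simp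
  then show "L h = L' h" using s by (simp add: L.scaleR L'.scaleR)
qed

lemma continuous_on_det:
  fixes A :: "'a::topological_space \<Rightarrow> real^'m^'m"
  assumes "\<And>i j. continuous_on S (\<lambda>x. A x $ i $ j)"
  shows "continuous_on S (\<lambda>x. det (A x))"
  unfolding det_def by (intro continuous_intros assms)

text \<open>Expanding \<open>z x\<close> in coordinates reduces the claim to fixed directions.\<close>

lemma continuous_on_apply_linear:
  fixes D :: "'a::topological_space \<Rightarrow> real^'m \<Rightarrow> 'b::real_normed_vector"
  assumes "\<And>x. x \<in> S \<Longrightarrow> linear (D x)" "\<And>h. continuous_on S (\<lambda>x. D x h)" "continuous_on S z"
  shows "continuous_on S (\<lambda>x. D x (z x))"
proof -
  have "D x (z x) = (\<Sum>i\<in>UNIV. z x $ i *\<^sub>R D x (axis i 1))" if "x \<in> S" for x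
  proof -
    have "z x = (\<Sum>i\<in>UNIV. z x $ i *\<^sub>R axis i 1)"
      using basis_expansion[of "z x"] by (simp add: scalar_mult_eq_scaleR)
    then have "D x (z x) = D x (\<Sum>i\<in>UNIV. z x $ i *\<^sub>R axis i 1)" by simp
    then show ?thesis
      using assms(1)[OF that] by (simp add: linear_sum linear_scale)
  qed
  moreover have "continuous_on S (\<lambda>x. \<Sum>i\<in>UNIV. z x $ i *\<^sub>R D x (axis i 1))"
    by (intro continuous_intros assms)
  ultimately show ?thesis by (simp cong: continuous_on_cong)
qed

lemma lagrange_element_simps:
  assumes "lagrange_element \<B> F e"
  shows "partition_on UNIV \<B>" "convex e" "compact e" "closed e" "C1_fun F"
    "inj_on F (ref_cell \<B>)" "F ` ref_cell \<B> = e"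
  using assms C1_fun_blockwise_affine polytope_imp_convex polytope_imp_compact polytope_imp_closed
  unfolding lagrange_element_def by blast+

lemma C1_fun_continuous: "C1_fun f \<Longrightarrow> continuous_on S f"
  unfolding C1_fun_def by (meson continuous_at_imp_continuous_on has_derivative_continuous)

text \<open>By invariance of domain the injective parametrisation maps the interior of the reference cell onto
  an open set.\<close>

lemma interior_element_nonempty:
  assumes "lagrange_element \<B> F e"
  shows "interior e \<noteq> {}"
proof -
  note e = lagrange_element_simps[OF assms]
  have "inj_on F (interior (ref_cell \<B>))"
    using e(6) interior_subset by (rule inj_on_subset)
  then have "open (F ` interior (ref_cell \<B>))"
    using C1_fun_continuous[OF e(5)] by (intro invariance_of_domain) auto
  moreover have "F ` interior (ref_cell \<B>) \<subseteq> e" using e(7) interior_subset by blast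
  ultimately have "F ` interior (ref_cell \<B>) \<subseteq> interior e" by (intro interior_maximal)
  then show ?thesis using interior_ref_cell_nonempty[of \<B>] by auto
qed

text \<open>On the element \<open>v\<close> is the composition of \<open>w\<close> with the inverse of the parametrisation, and this inverse is
  continuously differentiable up to the boundary as the Jacobian does not vanish on the closed
  cell.\<close>

lemma element_function_C1:
  fixes v w :: "real^'m \<Rightarrow> 'b::real_normed_vector"
  assumes el: "lagrange_element \<B> F e" and w: "C1_fun w"
    and vw: "\<And>x. x \<in> ref_cell \<B> \<Longrightarrow> v (F x) = w x"
  obtains D where "\<And>y. y \<in> e \<Longrightarrow> (v has_derivative D y) (at y within e)"
    "\<And>h. continuous_on e (\<lambda>y. D y h)"
proof -
  note e = lagrange_element_simps[OF el]
  let ?R = "ref_cell \<B>"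
  obtain DF where DF: "\<And>x. (F has_derivative DF x) (at x)" "\<And>h. continuous_on UNIV (\<lambda>x. DF x h)"
    using e(5) unfolding C1_fun_def by blast
  obtain Dw where Dw: "\<And>x. (w has_derivative Dw x) (at x)" "\<And>h. continuous_on UNIV (\<lambda>x. Dw x h)"
    using w unfolding C1_fun_def by blast
  define A where "A x = matrix (DF x)" for x
  have Av: "A x *v h = DF x h" for x h
    unfolding A_def using has_derivative_linear[OF DF(1)] by (simp add: matrix_works)
  have det: "det (A x) \<noteq> 0" if "x \<in> ?R" for x
    using el that frechet_derivative_at[OF DF(1)]
    unfolding lagrange_element_def jacobian_def A_def by metis
  \<comment> \<open>Cramer's rule exhibits the inverse of the derivative as a quotient of polynomials in its
    entries, hence as a continuous function of the base point.\<close>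
  define inv_DF where "inv_DF x h = (\<chi> k. det (\<chi> i j. if j = k then h $ i else A x $ i $ j) / det (A x))" for x h
  have solve: "A x *v z = h \<longleftrightarrow> z = inv_DF x h" if "x \<in> ?R" for x z h
    using cramer[OF det[OF that]] unfolding inv_DF_def by blast
  have lin_inv: "linear (inv_DF x)" if x: "x \<in> ?R" for x
  proof -
    have "A x *v inv_DF x h = h" for h using solve[OF x] by blast
    then have "A x *v (inv_DF x h + inv_DF x h') = h + h'" "A x *v (r *\<^sub>R inv_DF x h) = r *\<^sub>R h" for h h' r
      by (simp_all add: matrix_vector_right_distrib matrix_vector_mult_scaleR)
    then show ?thesis using solve[OF x] by (intro linearI) metis+
  qed
  have A_cont: "continuous_on S (\<lambda>x. A x $ i $ j)" for S i j
    unfolding A_def matrix_def using continuous_on_subset[OF DF(2)] by (auto intro!: continuous_intros)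
  have inv_cont: "continuous_on ?R (\<lambda>x. inv_DF x h)" for h
    unfolding inv_DF_def
  proof (intro continuous_on_vec_lambda continuous_on_divide continuous_on_det)
    show "continuous_on ?R (\<lambda>x. (\<chi> i j. if j = k then h $ i else A x $ i $ j) $ i $ j)" for k i j
      using A_cont by (cases "j = k") auto
  qed (use A_cont det in auto)
  define G where "G = inv_into ?R F"
  have GF: "G (F x) = x" if "x \<in> ?R" for x unfolding G_def using e(6) that by (rule inv_into_f_f)
  have Gin: "G y \<in> ?R" and FG: "F (G y) = y" if "y \<in> e" for y
    using that GF unfolding e(7)[symmetric] by auto
  have Gcont: "continuous_on e G"
    using continuous_on_inv[OF C1_fun_continuous[OF e(5)] compact_ref_cell[OF e(1)]] GF
    unfolding e(7) by blast
  have der: "(v has_derivative (\<lambda>h. Dw (G y) (inv_DF (G y) h))) (at y within e)" if y: "y \<in> e" for y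
  proof -
    have "(G has_derivative inv_DF (G y)) (at (F (G y)) within F ` ?R)"
    proof (rule has_derivative_inverse_within)
      show "(F has_derivative DF (G y)) (at (G y) within ?R)"
        using DF(1) by (rule has_derivative_at_withinI)
      show "continuous (at (F (G y)) within F ` ?R) G"
        using Gcont y unfolding e(7) FG[OF y] by (simp add: continuous_on_eq_continuous_within)
      show "inv_DF (G y) \<circ> DF (G y) = id"
      proof
        show "(inv_DF (G y) \<circ> DF (G y)) z = id z" for z
          using solve[OF Gin[OF y], of z "DF (G y) z"] by (simp add: Av)
      qed
    qed (use Gin[OF y] lin_inv GF in auto)
    then have "(G has_derivative inv_DF (G y)) (at y within e)" by (simp add: e(7) FG[OF y])
    then have "((\<lambda>y. w (G y)) has_derivative (\<lambda>h. Dw (G y) (inv_DF (G y) h))) (at y within e)"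
      by (rule has_derivative_compose) (rule Dw(1))
    moreover have "w (G z) = v z" if "z \<in> e" for z using vw[OF Gin[OF that]] FG[OF that] by simp
    ultimately show ?thesis
      using has_derivative_transform[OF y, of v "\<lambda>y. w (G y)"] by simp
  qed
  have "continuous_on e (\<lambda>y. Dw (G y) (inv_DF (G y) h))" for h
  proof (rule continuous_on_apply_linear)
    show "linear (Dw (G y))" for y using Dw(1) by (rule has_derivative_linear)
    show "continuous_on e (\<lambda>y. Dw (G y) h)" for h
      using continuous_on_compose2[OF Dw(2) Gcont] by simp
    show "continuous_on e (\<lambda>y. inv_DF (G y) h)"
      using continuous_on_compose2[OF inv_cont Gcont] Gin by blast
  qed
  with der show thesis by (rule that)
qed

lemma has_derivative_gradient:
  assumes "f differentiable (at x within S)"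
  shows "(f has_derivative (\<lambda>h. gradient S f x \<bullet> h)) (at x within S)"
proof -
  have D: "(f has_derivative frechet_derivative f (at x within S)) (at x within S)"
    using assms by (simp add: frechet_derivative_works)
  have "frechet_derivative f (at x within S) h = gradient S f x \<bullet> h" for h
  proof -
    have h: "h = (\<Sum>i\<in>UNIV. h $ i *\<^sub>R axis i 1)"
      using basis_expansion[of h] by (simp add: scalar_mult_eq_scaleR)
    have "frechet_derivative f (at x within S) h
        = (\<Sum>i\<in>UNIV. h $ i * frechet_derivative f (at x within S) (axis i 1))"
      using has_derivative_linear[OF D] by (subst h) (simp add: linear_sum linear_scale)
    then show ?thesis by (simp add: gradient_def inner_vec_def mult.commute)
  qed
  then have "frechet_derivative f (at x within S) = (\<lambda>h. gradient S f x \<bullet> h)" by (rule ext)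
  with D show ?thesis by (simp only:)
qed

lemma gradient_eqI:
  assumes S: "convex S" "interior S \<noteq> {}" "x \<in> S"
    and f: "(f has_derivative L) (at x within S)"
  shows "gradient S f x = (\<chi> i. L (axis i 1))"
proof -
  have "f differentiable (at x within S)" using f by (rule differentiableI)
  then have "frechet_derivative f (at x within S) = L"
    using derivative_unique_within_convex[OF S] f by (simp add: frechet_derivative_works)
  then show ?thesis by (simp add: gradient_def)
qed

lemma jacobian_eqI:
  fixes f :: "real^'m \<Rightarrow> real^'n"
  assumes S: "convex S" "interior S \<noteq> {}" "x \<in> S"
    and f: "(f has_derivative L) (at x within S)"
  shows "jacobian f (at x within S) = matrix L"
proof -
  have "f differentiable (at x within S)" using f by (rule differentiableI)
  then have "frechet_derivative f (at x within S) = L"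
    using derivative_unique_within_convex[OF S] f by (simp add: frechet_derivative_works)
  then show ?thesis by (simp add: jacobian_def)
qed

lemma lagrange_function_gradient:
  assumes grid: "conforming_grid \<Omega> \<G> \<B> F" and v: "v \<in> lagrange_space \<Omega> \<G> \<B> F" and e: "e \<in> \<G>"
  shows "\<And>y. y \<in> e \<Longrightarrow> (v has_derivative (\<lambda>h. gradient e v y \<bullet> h)) (at y within e)"
    and "continuous_on e (gradient e v)"
proof -
  have el: "lagrange_element (\<B> e) (F e) e" using grid e by (simp add: conforming_grid_def)
  obtain w where w: "blockwise_affine (\<B> e) w" "\<And>x. x \<in> ref_cell (\<B> e) \<Longrightarrow> v (F e x) = w x"
    using v e unfolding lagrange_space_def by blast
  note es = lagrange_element_simps[OF el]
  obtain D where D: "\<And>y. y \<in> e \<Longrightarrow> (v has_derivative D y) (at y within e)"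
    "\<And>h. continuous_on e (\<lambda>y. D y h)"
    using element_function_C1[OF el C1_fun_blockwise_affine[OF es(1) w(1)] w(2)] by blast
  show "(v has_derivative (\<lambda>h. gradient e v y \<bullet> h)) (at y within e)" if "y \<in> e" for y
    using D(1)[OF that] by (intro has_derivative_gradient differentiableI)
  have "gradient e v y = (\<chi> i. D y (axis i 1))" if "y \<in> e" for y
    using gradient_eqI[OF es(2) interior_element_nonempty[OF el] that D(1)[OF that]] .
  then show "continuous_on e (gradient e v)"
    using D(2) by (simp cong: continuous_on_cong) (intro continuous_on_vec_lambda)
qed

section \<open>Rigid displacements and facet-connected cells\<close>

lemma set_integrable_continuous_compact:
  fixes f :: "'a::euclidean_space \<Rightarrow> real"
  assumes "compact S" "continuous_on S f"
  shows "set_integrable lebesgue S f"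
  unfolding set_integrable_def
  using borel_integrable_compact[OF assms]
  by (subst integrable_completion) (auto dest: borel_measurable_integrable)

text \<open>A nonempty relatively open subset of a convex body meets the interior in a nonempty open set and so
  has positive measure.\<close>

lemma continuous_on_zero_from_interior:
  fixes f :: "'a::euclidean_space \<Rightarrow> 'b::real_normed_vector"
  assumes S: "convex S" "interior S \<noteq> {}" and f: "continuous_on S f"
    and N: "negligible N" and zero: "\<And>x. x \<in> S \<Longrightarrow> x \<notin> N \<Longrightarrow> f x = 0" and x: "x \<in> S"
  shows "f x = 0"
proof (rule ccontr)
  assume "f x \<noteq> 0"
  have "openin (top_of_set S) (S \<inter> f -` (- {0}))"
    using f by (intro continuous_openin_preimage_gen) auto
  then obtain U where U: "open U" "S \<inter> f -` (- {0}) = S \<inter> U" by (auto simp: openin_open)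
  have "x \<in> closure (interior S)"
    using convex_closure_interior[OF S] closure_subset x by blast
  moreover have "x \<in> U" using U(2) x \<open>f x \<noteq> 0\<close> by blast
  ultimately have "interior S \<inter> U \<noteq> {}"
    using open_Int_closure_eq_empty[OF U(1), of "interior S"] by blast
  moreover have "interior S \<inter> U \<subseteq> N" using U(2) zero interior_subset by blast
  ultimately show False
    using N open_not_negligible[of "interior S \<inter> U"] negligible_subset[OF N] U(1) by blast
qed

lemma continuous_nonneg_integral_zero:
  fixes f :: "'a::euclidean_space \<Rightarrow> real"
  assumes S: "compact S" "convex S" "interior S \<noteq> {}" and f: "continuous_on S f" "\<And>x. x \<in> S \<Longrightarrow> 0 \<le> f x"
    and int: "(LINT x:S|lebesgue. f x) = 0" and x: "x \<in> S"
  shows "f x = 0"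
proof -
  have "integrable lebesgue (\<lambda>x. indicator S x *\<^sub>R f x)"
    using set_integrable_continuous_compact[OF S(1) f(1)] by (simp add: set_integrable_def)
  moreover have "AE x in lebesgue. 0 \<le> indicator S x *\<^sub>R f x"
    using f(2) by (auto split: split_indicator)
  ultimately have "AE x in lebesgue. indicator S x *\<^sub>R f x = 0"
    using int integral_nonneg_eq_0_iff_AE unfolding set_lebesgue_integral_def by blast
  then obtain N where N: "N \<in> null_sets lebesgue" "{x \<in> space lebesgue. indicator S x *\<^sub>R f x \<noteq> 0} \<subseteq> N"
    by (auto simp: eventually_ae_filter)
  show ?thesis
  proof (rule continuous_on_zero_from_interior[OF S(2,3) f(1) _ _ x])
    show "negligible N" using N(1) by (simp add: negligible_iff_null_sets)
    fix y assume "y \<in> S" "y \<notin> N"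
    then show "f y = 0" using N(2) by (auto simp: indicator_def)
  qed
qed

text \<open>Along the segment from \<open>x\<close> to \<open>y\<close> the component of \<open>v\<close> in the direction of the segment has zero
  derivative.\<close>

lemma skew_derivative_imp_rigid:
  fixes v :: "'a::euclidean_space \<Rightarrow> 'a"
  assumes S: "convex S" "x \<in> S" "y \<in> S"
    and der: "\<And>z. z \<in> S \<Longrightarrow> (v has_derivative D z) (at z within S)"
    and skew: "\<And>z h. z \<in> S \<Longrightarrow> D z h \<bullet> h = 0"
  shows "(v x - v y) \<bullet> (x - y) = 0"
proof -
  let ?p = "\<lambda>t. x + t *\<^sub>R (y - x)"
  have p: "?p t \<in> S" if "t \<in> {0..1}" for t
  proof -
    have "?p t = (1 - t) *\<^sub>R x + t *\<^sub>R y" by (simp add: algebra_simps)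
    then show ?thesis using convexD_alt[OF S, of t] that by simp
  qed
  have "((\<lambda>t. v (?p t) \<bullet> (y - x)) has_derivative (\<lambda>h. 0)) (at t within {0..1})" if t: "t \<in> {0..1}" for t
  proof -
    have "((\<lambda>t. v (?p t)) has_derivative (\<lambda>s. s *\<^sub>R D (?p t) (y - x))) (at t within {0..1})"
      using derivative_on_segment[OF S t der[OF p[OF t]]] by (simp add: has_vector_derivative_def)
    from has_derivative_inner_left[OF this, of "y - x"] show ?thesis
      by (simp add: skew[OF p[OF t]])
  qed
  then obtain c where "\<And>t. t \<in> {0..1} \<Longrightarrow> v (?p t) \<bullet> (y - x) = c"
    using has_derivative_zero_constant[of "{0..1::real}" "\<lambda>t. v (?p t) \<bullet> (y - x)"] by auto
  from this[of 0] this[of 1] have "v x \<bullet> (y - x) = v y \<bullet> (y - x)" by simp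
  then show ?thesis by (simp add: inner_diff_left inner_diff_right)
qed

text \<open>If \<open>v x \<noteq> 0\<close>, then \<open>T\<close> and \<open>x\<close> lie in the hyperplane through \<open>x\<close> with normal \<open>v x\<close>. Since \<open>T\<close> spans at
  least a hyperplane, \<open>x\<close> lies in its affine hull, which is negligible; continuity does the rest. No
  explicit form of rigid displacements enters.\<close>

lemma rigid_vanishing_on_facet:
  fixes v :: "'a::euclidean_space \<Rightarrow> 'a"
  assumes S: "convex S" "interior S \<noteq> {}" and v: "continuous_on S v"
    and rigid: "\<And>x y. x \<in> S \<Longrightarrow> y \<in> S \<Longrightarrow> (v x - v y) \<bullet> (x - y) = 0"
    and T: "T \<subseteq> S" "aff_dim T \<ge> DIM('a) - 1" "\<And>x. x \<in> T \<Longrightarrow> v x = 0" and x: "x \<in> S"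
  shows "v x = 0"
proof -
  have off: "x \<in> affine hull T \<and> aff_dim T = DIM('a) - 1" if x: "x \<in> S" "v x \<noteq> 0" for x
  proof -
    let ?H = "{z. v x \<bullet> z = v x \<bullet> x}"
    have "insert x T \<subseteq> ?H"
      using rigid[OF x(1)] T(1,3) by (force simp: inner_diff_right)
    then have "aff_dim (insert x T) \<le> DIM('a) - 1"
      using aff_dim_subset aff_dim_hyperplane[OF x(2)] by metis
    then show ?thesis using T(2) by (auto simp: aff_dim_insert split: if_splits)
  qed
  show ?thesis
  proof (cases "aff_dim T = DIM('a) - 1")
    case True
    show ?thesis
    proof (rule continuous_on_zero_from_interior[OF S v _ _ x])
      show "negligible (affine hull T)"
        using True by (intro negligible_convex_interior[THEN iffD2] low_dim_interior)
          (auto simp: convex_affine_hull affine_imp_convex)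
    qed (use off in blast)
  qed (use off x in blast)
qed

text \<open>Suppose that \<open>P\<close> misses a cell. As \<open>\<Omega>\<close> is connected, the closed union of the cells in \<open>P\<close> and
  that of the remaining cells meet at a point \<open>x0\<close> of \<open>\<Omega>\<close>. Near \<open>x0\<close> two interior points of cells on
  either side are joined by a segment, which must pass through a common point of two cells on
  different sides. By hypothesis such cells intersect in codimension at least two, and a segment with
  generic endpoints avoids these finitely many intersections.\<close>

lemma cells_facet_connected:
  fixes \<Omega> :: "'a::euclidean_space set"
  assumes \<Omega>: "open \<Omega>" "connected \<Omega>"
    and \<G>: "finite \<G>" "\<Omega> \<subseteq> \<Union>\<G>"
    and cells: "\<And>e. e \<in> \<G> \<Longrightarrow> convex e \<and> closed e \<and> interior e \<noteq> {} \<and> e \<inter> \<Omega> \<noteq> {}"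
    and P: "P \<subseteq> \<G>" "P \<noteq> {}"
    and step: "\<And>e e'. e \<in> P \<Longrightarrow> e' \<in> \<G> \<Longrightarrow> aff_dim (e \<inter> e') \<ge> DIM('a) - 1 \<Longrightarrow> e' \<in> P"
  shows "P = \<G>"
proof (rule ccontr)
  assume "P \<noteq> \<G>"
  define Q where "Q = \<G> - P"
  have Q: "Q \<subseteq> \<G>" "Q \<noteq> {}" using P \<open>P \<noteq> \<G>\<close> by (auto simp: Q_def)
  have fin: "finite P" "finite Q" using P(1) Q(1) \<G>(1) finite_subset by blast+
  have "closed (\<Union>P)" "closed (\<Union>Q)"
    using fin P Q cells by (auto intro!: closed_Union)
  moreover have "\<Omega> \<subseteq> \<Union>P \<union> \<Union>Q" using \<G>(2) by (auto simp: Q_def)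
  moreover have "\<Union>P \<inter> \<Omega> \<noteq> {}" "\<Union>Q \<inter> \<Omega> \<noteq> {}" using P Q cells by blast+
  ultimately obtain x0 where x0: "x0 \<in> \<Union>P" "x0 \<in> \<Union>Q" "x0 \<in> \<Omega>"
    using \<Omega>(2) unfolding connected_closed by blast
  then obtain e1 e2 where e1: "e1 \<in> P" "x0 \<in> e1" and e2: "e2 \<in> Q" "x0 \<in> e2" by blast
  obtain r where r: "r > 0" "ball x0 r \<subseteq> \<Omega>" using \<Omega>(1) x0(3) open_contains_ball by blast
  have meets: "interior e \<inter> ball x0 r \<noteq> {}" if "e \<in> \<G>" "x0 \<in> e" for e
  proof -
    have "x0 \<in> closure (interior e)"
      using cells[OF that(1)] convex_closure_interior[of e] closure_subset that(2) by blast
    then show ?thesis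
      using open_Int_closure_eq_empty[of "ball x0 r" "interior e"] r(1)
      by (metis IntI Int_commute centre_in_ball empty_iff open_ball)
  qed
  \<comment> \<open>Pairs of cells on different sides; they intersect in codimension at least two.\<close>
  define L where "L = {(e, e'). e \<in> P \<and> e' \<in> Q}"
  have finL: "finite L" using fin by (simp add: L_def Sigma_def[symmetric] finite_subset[of _ "P \<times> Q"] subset_iff)
  have low: "aff_dim (e \<inter> e') \<le> int DIM('a) - 2" if "(e, e') \<in> L" for e e'
  proof -
    have "e \<in> P" "e' \<in> \<G>" "e' \<notin> P" using that by (auto simp: L_def Q_def)
    then have "aff_dim (e \<inter> e') < int (DIM('a) - 1)" using step[of e e'] by linarith
    then show ?thesis using DIM_positive[where 'a='a] by linarith
  qed
  have neg_hull: "negligible (affine hull T)" if "aff_dim T < int DIM('a)" for T :: "'a set"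
    using that by (intro negligible_convex_interior[THEN iffD2] low_dim_interior)
      (auto simp: convex_affine_hull affine_imp_convex)
  have avoid: "\<exists>a \<in> interior e \<inter> ball x0 r. a \<notin> N" if "e \<in> \<G>" "x0 \<in> e" "negligible N" for e N
    using meets[OF that(1,2)] open_not_negligible[of "interior e \<inter> ball x0 r"]
      negligible_subset[OF that(3)] by blast
  have "negligible (\<Union>(e, e')\<in>L. affine hull (e \<inter> e'))"
  proof (rule negligible_Union)
    fix T assume "T \<in> (\<lambda>(e, e'). affine hull (e \<inter> e')) ` L"
    then obtain e e' where "(e, e') \<in> L" "T = affine hull (e \<inter> e')" by auto
    then show "negligible T" using low[of e e'] neg_hull by auto
  qed (simp add: finL)
  then obtain a where a: "a \<in> interior e1" "a \<in> ball x0 r" "\<And>e e'. (e, e') \<in> L \<Longrightarrow> a \<notin> affine hull (e \<inter> e')"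
    using avoid[of e1] e1 P(1) by blast
  \<comment> \<open>Adding the point \<open>a\<close> raises the dimension by at most one, so these hulls are still negligible; a
    segment from \<open>a\<close> that hits \<open>e \<inter> e'\<close> would end in such a hull.\<close>
  have "negligible (\<Union>(e, e')\<in>L. affine hull (insert a (e \<inter> e')))"
  proof (rule negligible_Union)
    fix T assume "T \<in> (\<lambda>(e, e'). affine hull (insert a (e \<inter> e'))) ` L"
    then obtain e e' where "(e, e') \<in> L" "T = affine hull (insert a (e \<inter> e'))" by auto
    then show "negligible T" using low[of e e'] neg_hull by (auto simp: aff_dim_insert)
  qed (simp add: finL)
  then obtain b where b: "b \<in> interior e2" "b \<in> ball x0 r"
    "\<And>e e'. (e, e') \<in> L \<Longrightarrow> b \<notin> affine hull (insert a (e \<inter> e'))"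
    using avoid[of e2] e2 Q(1) by blast
  have "closed_segment a b \<subseteq> \<Omega>"
    using a(2) b(2) r(2) closed_segment_subset[OF _ _ convex_ball] by blast
  then have "closed_segment a b \<subseteq> \<Union>P \<union> \<Union>Q" using \<open>\<Omega> \<subseteq> \<Union>P \<union> \<Union>Q\<close> by blast
  moreover have "\<Union>P \<inter> closed_segment a b \<noteq> {}" "\<Union>Q \<inter> closed_segment a b \<noteq> {}"
    using a(1) b(1) e1(1) e2(1) interior_subset by (blast intro: ends_in_segment)+
  ultimately obtain y where y: "y \<in> \<Union>P" "y \<in> \<Union>Q" "y \<in> closed_segment a b"
    using connected_segment(1)[of a b] \<open>closed (\<Union>P)\<close> \<open>closed (\<Union>Q)\<close> unfolding connected_closed by blast
  then obtain e e' where ee: "(e, e') \<in> L" "y \<in> e \<inter> e'" by (auto simp: L_def)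
  have "y \<noteq> a" using a(3)[OF ee(1)] ee(2) hull_inc by metis
  obtain t where t: "y = (1 - t) *\<^sub>R a + t *\<^sub>R b" using y(3) by (auto simp: in_segment)
  have "t \<noteq> 0" using t \<open>y \<noteq> a\<close> by auto
  then have "b = (1 - 1 / t) *\<^sub>R a + (1 / t) *\<^sub>R y"
    unfolding t by (simp add: algebra_simps)
  moreover have "a \<in> affine hull (insert a (e \<inter> e'))" "y \<in> affine hull (insert a (e \<inter> e'))"
    using ee(2) by (auto intro: hull_inc)
  ultimately have "b \<in> affine hull (insert a (e \<inter> e'))"
    using mem_affine[OF affine_affine_hull, of a "insert a (e \<inter> e')" y "1 - 1 / t" "1 / t"] by simp
  then show False using b(3)[OF ee(1)] by blast
qed

section \<open>Discrete Korn inequality\<close>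

locale lagrange_grid =
  fixes \<Omega> :: "(real^'m) set" and \<G> :: "(real^'m) set set" and \<B> :: "(real^'m) set \<Rightarrow> 'm set set"
    and F :: "(real^'m) set \<Rightarrow> real^'m \<Rightarrow> real^'m"
    and p :: "'n::finite \<Rightarrow> real^'m" and \<theta> :: "'n \<Rightarrow> real^'m \<Rightarrow> real"
  assumes domain: "polyhedral_domain \<Omega>"
    and grid: "conforming_grid \<Omega> \<G> \<B> F"
    and basis: "lagrange_nodal_basis \<Omega> \<G> \<B> F p \<theta>"
begin

lemma finite_grid: "finite \<G>" and grid_cover: "\<Union>\<G> = closure \<Omega>"
  using grid by (auto simp: conforming_grid_def)

lemma element: "e \<in> \<G> \<Longrightarrow> lagrange_element (\<B> e) (F e) e"
  using grid by (simp add: conforming_grid_def)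

lemmas element_simps = lagrange_element_simps[OF element]
lemmas element_interior = interior_element_nonempty[OF element]

lemma basis_in_space: "\<theta> i \<in> lagrange_space \<Omega> \<G> \<B> F"
  using basis by (simp add: lagrange_nodal_basis_def)

lemmas basis_gradient = lagrange_function_gradient[OF grid basis_in_space]

lemma fe_fun_node: "fe_fun \<theta> c (p j) = c $ j"
proof -
  have "fe_fun \<theta> c (p j) = (\<Sum>i\<in>UNIV. if i = j then c $ i else 0)"
    using basis unfolding fe_fun_def lagrange_nodal_basis_def by (intro sum.cong) auto
  then show ?thesis by simp
qed

lemma vertex_is_node: "e \<in> \<G> \<Longrightarrow> x \<in> vertices e \<Longrightarrow> x \<in> range p"
  using basis by (auto simp: lagrange_nodal_basis_def grid_nodes_def)

lemma node_in_element: obtains e where "e \<in> \<G>" "p j \<in> e"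
proof -
  have "p j \<in> grid_nodes \<G>" using basis by (auto simp: lagrange_nodal_basis_def)
  then show thesis
    using that by (auto simp: grid_nodes_def vertices_def extreme_point_of_def)
qed

lemma fe_fun_has_derivative:
  fixes c :: "'b::real_normed_vector^'n"
  assumes "e \<in> \<G>" "y \<in> e"
  shows "(fe_fun \<theta> c has_derivative (\<lambda>h. \<Sum>i\<in>UNIV. (gradient e (\<theta> i) y \<bullet> h) *\<^sub>R c $ i)) (at y within e)"
  unfolding fe_fun_def[abs_def]
  by (intro has_derivative_sum has_derivative_scaleR_left basis_gradient(1) assms)

lemma fe_fun_continuous_on:
  fixes c :: "'b::real_normed_vector^'n"
  assumes "e \<in> \<G>" shows "continuous_on e (fe_fun \<theta> c)"
  using fe_fun_has_derivative[OF assms]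
  by (meson continuous_on_eq_continuous_within has_derivative_continuous)

text \<open>The pull-back to the reference cell is blockwise affine and the vertices of the cell correspond to
  nodes, where the values are the coefficients.\<close>

lemma fe_fun_lower_bound:
  fixes c :: "real^'n"
  assumes c: "\<And>i. a \<le> c $ i" and e: "e \<in> \<G>" "x \<in> e"
  shows "a \<le> fe_fun \<theta> c x"
proof -
  note es = element_simps[OF e(1)]
  have "\<exists>w. blockwise_affine (\<B> e) w \<and> (\<forall>x\<in>ref_cell (\<B> e). \<theta> i (F e x) = w x)" for i
    using basis_in_space e(1) by (simp add: lagrange_space_def)
  then obtain w where w: "\<And>i. blockwise_affine (\<B> e) (w i)"
    "\<And>i x. x \<in> ref_cell (\<B> e) \<Longrightarrow> \<theta> i (F e x) = w i x" by metis
  define W where "W x = (\<Sum>i\<in>UNIV. w i x * c $ i) - a" for x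
  have W: "W x = fe_fun \<theta> c (F e x) - a" if "x \<in> ref_cell (\<B> e)" for x
    using w(2)[OF that] by (simp add: W_def fe_fun_def)
  have "blockwise_affine (\<B> e) W"
    unfolding blockwise_affine_def
  proof (intro ballI allI impI)
    fix b x y t assume b: "b \<in> \<B> e" and xy: "\<forall>i. i \<notin> b \<longrightarrow> x $ i = (y :: real^'m) $ i"
    have "w i ((1 - t) *\<^sub>R x + t *\<^sub>R y) = (1 - t) * w i x + t * w i y" for i
      using w(1)[of i] b xy by (simp add: blockwise_affine_def)
    then have "(\<Sum>i\<in>UNIV. w i ((1 - t) *\<^sub>R x + t *\<^sub>R y) * c $ i)
        = (1 - t) * (\<Sum>i\<in>UNIV. w i x * c $ i) + t * (\<Sum>i\<in>UNIV. w i y * c $ i)"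
      by (simp add: distrib_right sum.distrib sum_distrib_left mult.assoc)
    then show "W ((1 - t) *\<^sub>R x + t *\<^sub>R y) = (1 - t) *\<^sub>R W x + t *\<^sub>R W y"
      unfolding W_def by (simp only: real_scaleR_def) (simp add: algebra_simps)
  qed
  moreover have "0 \<le> W x" if x: "x \<in> vertices (ref_cell (\<B> e))" for x
  proof -
    have "F e x \<in> vertices e" using element[OF e(1)] x by (auto simp: lagrange_element_def)
    then obtain j where "F e x = p j" using vertex_is_node[OF e(1)] by blast
    moreover have "x \<in> ref_cell (\<B> e)" using x by (simp add: vertices_def extreme_point_of_def)
    ultimately show ?thesis using W c[of j] by (simp add: fe_fun_node)
  qed
  ultimately have nonneg: "0 \<le> W z" if "z \<in> ref_cell (\<B> e)" for z
    using blockwise_affine_nonneg[OF es(1)] that by blast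
  obtain z where "z \<in> ref_cell (\<B> e)" "x = F e z" using e(2) es(7) by blast
  then show ?thesis using W[of z] nonneg[of z] by simp
qed

lemma fe_fun_linear: "linear (\<lambda>c. fe_fun \<theta> c x)"
  by (rule linearI) (simp_all add: fe_fun_def scaleR_add_right sum.distrib scaleR_sum_right mult.commute)

lemma fe_fun_unit_interval:
  fixes c :: "real^'n"
  assumes c: "\<And>i. c $ i \<in> {0..1}" and e: "e \<in> \<G>" "x \<in> e"
  shows "fe_fun \<theta> c x \<in> {0..1}"
proof -
  have "- 1 \<le> fe_fun \<theta> (- c) x" using c by (intro fe_fun_lower_bound[OF _ e]) auto
  moreover have "0 \<le> fe_fun \<theta> c x" using c by (intro fe_fun_lower_bound[OF _ e]) auto
  ultimately show ?thesis by (simp add: linear_neg[OF fe_fun_linear])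
qed

text \<open>This formula shows at once that the strain is linear in \<open>u\<close> and continuous on the closed element.\<close>

lemma strain_fe_fun:
  fixes u :: "real^'m^'n"
  assumes "e \<in> \<G>" "y \<in> e"
  shows "strain e (fe_fun \<theta> u) y = sym_part (\<chi> r s. \<Sum>i\<in>UNIV. gradient e (\<theta> i) y $ s * u $ i $ r)"
proof -
  have "jacobian (fe_fun \<theta> u) (at y within e) = (\<chi> r s. \<Sum>i\<in>UNIV. gradient e (\<theta> i) y $ s * u $ i $ r)"
    unfolding jacobian_eqI[OF element_simps(2)[OF assms(1)] element_interior[OF assms(1)] assms(2)
        fe_fun_has_derivative[OF assms]]
    by (simp add: matrix_def vec_eq_iff inner_axis)
  then show ?thesis by (simp add: strain_def sym_part_def)
qed

lemma strain_sym: "strain e v y \<in> sym_matrices"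
  unfolding strain_def sym_part_def[symmetric] by (rule sym_part_in_sym_matrices)

lemma linear_strain:
  assumes "e \<in> \<G>" "y \<in> e"
  shows "linear (\<lambda>u :: real^'m^'n. strain e (fe_fun \<theta> u) y)"
proof -
  have "linear (\<lambda>u :: real^'m^'n. \<chi> r s. \<Sum>i\<in>UNIV. gradient e (\<theta> i) y $ s * u $ i $ r)"
    by (rule linearI) (simp_all add: vec_eq_iff sum.distrib sum_distrib_left algebra_simps)
  from linear_compose[OF this linear_sym_part] show ?thesis
    using strain_fe_fun[OF assms] by (simp add: o_def)
qed

lemma continuous_on_strain:
  fixes u :: "real^'m^'n"
  assumes "e \<in> \<G>"
  shows "continuous_on e (strain e (fe_fun \<theta> u))"
proof -
  have "continuous_on e (\<lambda>y. sym_part (\<chi> r s. \<Sum>i\<in>UNIV. gradient e (\<theta> i) y $ s * u $ i $ r))"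
    using basis_gradient(2)[OF assms] unfolding sym_part_def transpose_def
    by (intro continuous_intros) auto
  then show ?thesis using strain_fe_fun[OF assms] by (simp cong: continuous_on_cong)
qed

text \<open>Vanishing strain means that the Jacobian is skew-symmetric.\<close>

lemma zero_strain_imp_rigid:
  fixes u :: "real^'m^'n"
  assumes e: "e \<in> \<G>" "x \<in> e" "y \<in> e" and zero: "\<And>z. z \<in> e \<Longrightarrow> strain e (fe_fun \<theta> u) z = 0"
  shows "(fe_fun \<theta> u x - fe_fun \<theta> u y) \<bullet> (x - y) = 0"
proof (rule skew_derivative_imp_rigid[OF element_simps(2)[OF e(1)] e(2,3) fe_fun_has_derivative[OF e(1)]])
  fix z h :: "real^'m" assume z: "z \<in> e"
  let ?D = "\<lambda>h. \<Sum>i\<in>UNIV. (gradient e (\<theta> i) z \<bullet> h) *\<^sub>R u $ i"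
  define A where "A = matrix ?D"
  have "linear ?D" using fe_fun_has_derivative[OF e(1) z] by (rule has_derivative_linear)
  then have D: "?D h = A *v h" unfolding A_def by (simp add: matrix_works)
  have "strain e (fe_fun \<theta> u) z = sym_part A"
    unfolding strain_def sym_part_def A_def
      jacobian_eqI[OF element_simps(2)[OF e(1)] element_interior[OF e(1)] z fe_fun_has_derivative[OF e(1) z]] ..
  then have "A + transpose A = 0" using zero[OF z] by (simp add: sym_part_def)
  then have "transpose A = - A" by (simp add: add_eq_0_iff)
  moreover have "(A *v h) \<bullet> h = h \<bullet> (transpose A *v h)"
    using dot_lmul_matrix[of h A h] by (simp add: transpose_matrix_vector inner_commute)
  moreover have "(- A) *v h = - (A *v h)"
    by (simp add: matrix_vector_mult_def vec_eq_iff sum_negf)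
  ultimately have "(A *v h) \<bullet> h = - ((A *v h) \<bullet> h)"
    by (simp add: inner_commute)
  then show "?D h \<bullet> h = 0" unfolding D by simp
qed

text \<open>The displacement is rigid on each element and vanishes on the Dirichlet face. The elements on which it
  vanishes are closed under passing to an element that shares a set of codimension at most one, so
  they are all elements.\<close>

lemma zero_strain_imp_zero:
  fixes u :: "real^'m^'n"
  assumes face: "\<exists>f. boundary_grid_face \<Omega> \<G> f \<and> vertices f \<subseteq> grid_nodes \<G> \<inter> \<Gamma>u"
    and u: "\<And>i. p i \<in> \<Gamma>u \<Longrightarrow> u $ i = 0"
    and zero: "\<And>e z. e \<in> \<G> \<Longrightarrow> z \<in> e \<Longrightarrow> strain e (fe_fun \<theta> u) z = 0"
  shows "u = 0"
proof -
  let ?v = "fe_fun \<theta> u"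
  have spread: "\<forall>x\<in>e. ?v x = 0"
    if e: "e \<in> \<G>" and T: "T \<subseteq> e" "aff_dim T \<ge> DIM(real^'m) - 1" "\<And>x. x \<in> T \<Longrightarrow> ?v x = 0" for e T
  proof
    fix x assume x: "x \<in> e"
    show "?v x = 0"
      by (rule rigid_vanishing_on_facet[OF element_simps(2)[OF e] element_interior[OF e]
            fe_fun_continuous_on[OF e] zero_strain_imp_rigid[OF e _ _ zero[OF e]] T x])
  qed
  define P where "P = {e \<in> \<G>. \<forall>x\<in>e. ?v x = 0}"
  obtain f e0 where f: "e0 \<in> \<G>" "f facet_of e0" "vertices f \<subseteq> grid_nodes \<G> \<inter> \<Gamma>u"
    using face unfolding boundary_grid_face_def by blast
  have "e0 \<in> P"
  proof -
    note es = element_simps[OF f(1)]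
    have face: "f face_of e0" and "aff_dim f = aff_dim e0 - 1"
      using f(2) by (auto simp: facet_of_def)
    moreover have "aff_dim e0 = DIM(real^'m)"
      using element_interior[OF f(1)] by (rule aff_dim_nonempty_interior)
    moreover have "f = convex hull (vertices f)"
      unfolding vertices_def using face es
      by (intro Krein_Milman_Minkowski) (auto intro: face_of_imp_compact face_of_imp_convex)
    ultimately have "aff_dim (vertices f) = int DIM(real^'m) - 1"
      by (metis aff_dim_convex_hull)
    then have "aff_dim (vertices f) \<ge> int (DIM(real^'m) - 1)" by simp
    moreover have "vertices f \<subseteq> e0"
      using face face_of_imp_subset by (force simp: vertices_def extreme_point_of_def)
    moreover have "?v x = 0" if "x \<in> vertices f" for x
    proof -
      have "x \<in> range p" using that f(3) basis unfolding lagrange_nodal_basis_def by blast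
      then obtain i where "x = p i" by blast
      then show ?thesis using u[of i] that f(3) by (auto simp: fe_fun_node)
    qed
    ultimately show ?thesis unfolding P_def using spread[OF f(1)] f(1) by blast
  qed
  have "P = \<G>"
  proof (rule cells_facet_connected[where \<Omega> = \<Omega>])
    show "open \<Omega>" "connected \<Omega>" using domain by (auto simp: polyhedral_domain_def)
    show "finite \<G>" by (rule finite_grid)
    show "\<Omega> \<subseteq> \<Union>\<G>" using grid_cover closure_subset by blast
    show "P \<subseteq> \<G>" by (auto simp: P_def)
    show "P \<noteq> {}" using \<open>e0 \<in> P\<close> by blast
    show "convex e \<and> closed e \<and> interior e \<noteq> {} \<and> e \<inter> \<Omega> \<noteq> {}" if "e \<in> \<G>" for e
    proof -
      have "interior e \<inter> closure \<Omega> \<noteq> {}"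
        using element_interior[OF that] grid_cover that interior_subset by blast
      then have "interior e \<inter> \<Omega> \<noteq> {}" using open_Int_closure_eq_empty[of "interior e" \<Omega>] by simp
      then show ?thesis using element_simps[OF that] element_interior[OF that] interior_subset by blast
    qed
    show "e' \<in> P" if "e \<in> P" "e' \<in> \<G>" "aff_dim (e \<inter> e') \<ge> DIM(real^'m) - 1" for e e'
      using that spread[OF that(2), of "e \<inter> e'"] by (auto simp: P_def)
  qed
  have "u $ j = 0" for j
  proof -
    obtain e where "e \<in> \<G>" "p j \<in> e" using node_in_element .
    then have "?v (p j) = 0" using \<open>P = \<G>\<close> by (auto simp: P_def)
    then show ?thesis by (simp add: fe_fun_node)
  qed
  then show ?thesis by (simp add: vec_eq_iff)
qed

text \<open>The quadrature approximation of the squared \<open>L\<^sup>2\<close> norm of the strain.\<close>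

definition discrete_strain_energy ::
  "nat \<Rightarrow> ((real^'m) set \<Rightarrow> nat \<Rightarrow> real^'m) \<Rightarrow> ((real^'m) set \<Rightarrow> nat \<Rightarrow> real) \<Rightarrow> real^'m^'n \<Rightarrow> real" where
  "discrete_strain_energy amax q \<omega> u =
     (\<Sum>e\<in>\<G>. \<Sum>\<alpha>=1..amax. (norm (strain e (fe_fun \<theta> u) (q e \<alpha>)))\<^sup>2 * \<omega> e \<alpha>)"

text \<open>A quadratic form that is positive definite on a finite-dimensional space is bounded below by its
  minimum on the unit sphere times the squared norm. For definiteness, exactness of the quadrature turns a
  vanishing sum into a vanishing integral of a continuous function on each element.\<close>

lemma discrete_korn:
  assumes face: "\<exists>f. boundary_grid_face \<Omega> \<G> f \<and> vertices f \<subseteq> grid_nodes \<G> \<inter> \<Gamma>u"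
    and quad: "admissible_quadrature \<G> \<theta> amax q \<omega>"
  obtains c where "c > 0"
    "\<And>u. (\<And>i. p i \<in> \<Gamma>u \<Longrightarrow> u $ i = 0) \<Longrightarrow> c * (norm u)\<^sup>2 \<le> discrete_strain_energy amax q \<omega> u"
proof -
  let ?Q = "discrete_strain_energy amax q \<omega>"
  have q: "q e \<alpha> \<in> e" "\<omega> e \<alpha> > 0" if "e \<in> \<G>" "\<alpha> \<in> {1..amax}" for e \<alpha>
    using quad that by (auto simp: admissible_quadrature_def)
  have nonneg: "0 \<le> (\<Sum>\<alpha>=1..amax. (norm (strain e (fe_fun \<theta> u) (q e \<alpha>)))\<^sup>2 * \<omega> e \<alpha>)"
    if "e \<in> \<G>" for e and u :: "real^'m^'n"
    using q(2)[OF that] by (intro sum_nonneg mult_nonneg_nonneg) (auto intro: less_imp_le)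
  have zero: "u = 0" if u: "\<And>i. p i \<in> \<Gamma>u \<Longrightarrow> u $ i = 0" and Q0: "?Q u = 0" for u
  proof (rule zero_strain_imp_zero[OF face u])
    fix e z assume e: "e \<in> \<G>" and z: "z \<in> e"
    have "(\<Sum>\<alpha>=1..amax. (norm (strain e (fe_fun \<theta> u) (q e \<alpha>)))\<^sup>2 * \<omega> e \<alpha>) = 0"
      using Q0 nonneg e finite_grid unfolding discrete_strain_energy_def
      by (subst (asm) sum_nonneg_eq_0_iff) auto
    moreover have "(\<Sum>\<alpha>=1..amax. (norm (strain e (fe_fun \<theta> u) (q e \<alpha>)))\<^sup>2 * \<omega> e \<alpha>)
        = (LINT x:e|lebesgue. (norm (strain e (fe_fun \<theta> u) x))\<^sup>2)"
      using quad e unfolding admissible_quadrature_def by blast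
    ultimately have "(LINT x:e|lebesgue. (norm (strain e (fe_fun \<theta> u) x))\<^sup>2) = 0" by linarith
    then have "(norm (strain e (fe_fun \<theta> u) z))\<^sup>2 = 0"
      using continuous_nonneg_integral_zero[OF element_simps(3)[OF e] element_simps(2)[OF e]
          element_interior[OF e] continuous_on_power[OF continuous_on_norm[OF continuous_on_strain[OF e]]] _ _ z]
      by simp
    then show "strain e (fe_fun \<theta> u) z = 0" by simp
  qed
  have Q_nonneg: "0 \<le> ?Q u" for u
    unfolding discrete_strain_energy_def by (intro sum_nonneg nonneg)
  have Q_scale: "?Q (r *\<^sub>R u) = r\<^sup>2 * ?Q u" for r u
    unfolding discrete_strain_energy_def sum_distrib_left
    using linear_scale[OF linear_strain[OF _ q(1)]]
    by (intro sum.cong refl) (simp add: power_mult_distrib)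
  have "continuous_on UNIV (\<lambda>u :: real^'m^'n. strain e (fe_fun \<theta> u) (q e \<alpha>))"
    if "e \<in> \<G>" "\<alpha> \<in> {1..amax}" for e \<alpha>
    using linear_strain[OF that(1) q(1)[OF that]] by (intro linear_continuous_on) (simp add: linear_conv_bounded_linear)
  then have Q_cont: "continuous_on S ?Q" for S
    unfolding discrete_strain_energy_def[abs_def]
    by (intro continuous_intros) (auto intro: continuous_on_subset)
  let ?V = "{u :: real^'m^'n. \<forall>i. p i \<in> \<Gamma>u \<longrightarrow> u $ i = 0}"
  have "?V = (\<Inter>i\<in>{i. p i \<in> \<Gamma>u}. {u. u $ i = 0})" by auto
  also have "closed \<dots>" by (intro closed_INT ballI closed_Collect_eq continuous_intros)
  finally have compact: "compact (sphere 0 1 \<inter> ?V)" by (intro compact_Int_closed compact_sphere)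
  have normalize: "(1 / norm u) *\<^sub>R u \<in> sphere 0 1 \<inter> ?V" if "u \<in> ?V" "u \<noteq> 0" for u
    using that by simp
  show thesis
  proof (cases "sphere 0 1 \<inter> ?V = {}")
    case True
    then have "u = 0" if "\<And>i. p i \<in> \<Gamma>u \<Longrightarrow> u $ i = 0" for u :: "real^'m^'n"
      using normalize[of u] that by blast
    then show thesis using Q_nonneg by (intro that[of 1]) fastforce+
  next
    case False
    obtain u0 where u0: "u0 \<in> sphere 0 1 \<inter> ?V" "\<And>u. u \<in> sphere 0 1 \<inter> ?V \<Longrightarrow> ?Q u0 \<le> ?Q u"
      using continuous_attains_inf[OF compact False Q_cont] by blast
    have "?Q u0 \<noteq> 0" using zero[of u0] u0(1) by auto
    then have pos: "?Q u0 > 0" using Q_nonneg[of u0] by simp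
    show thesis
    proof (rule that[OF pos])
      fix u assume u: "\<And>i. p i \<in> \<Gamma>u \<Longrightarrow> u $ i = (0 :: real^'m)"
      show "?Q u0 * (norm u)\<^sup>2 \<le> ?Q u"
      proof (cases "u = 0")
        case False
        have "?Q u0 \<le> ?Q ((1 / norm u) *\<^sub>R u)" using u False by (intro u0(2) normalize) auto
        then show ?thesis using False unfolding Q_scale by (simp add: field_simps)
      qed (simp add: Q_nonneg)
    qed
  qed
qed

end

section \<open>Bulk and crack energy\<close>

lemma convex_on_finite_sum:
  fixes f :: "'i \<Rightarrow> 'a::real_vector \<Rightarrow> real"
  assumes "finite I" "convex S" "\<And>i. i \<in> I \<Longrightarrow> convex_on S (f i)"
  shows "convex_on S (\<lambda>x. \<Sum>i\<in>I. f i x)"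
  using assms(1,3)
proof (induction I rule: finite_induct)
  case empty
  then show ?case using assms(2) by (simp add: convex_on_const)
next
  case (insert i I)
  then show ?case by (simp add: convex_on_add)
qed

lemma mem_damage_box: "d \<in> cbox a 1 \<longleftrightarrow> (\<forall>i. d $ i \<in> {a $ i..1})" for a d :: "real^'n"
  by (simp add: mem_box_cart)

lemma degradation_continuous:
  assumes "degradation_function g" shows "continuous_on {0..1} g"
proof -
  obtain g' where "\<forall>x\<in>{0..1}. (g has_real_derivative g' x) (at x within {0..1})"
    using assms unfolding degradation_function_def C2_on_def by blast
  then show ?thesis by (auto intro!: DERIV_continuous_on)
qed

text \<open>This keeps the factor \<open>1 / (4 * crack_c \<beta>)\<close> nonnegative, its default value \<open>1 / 0 = 0\<close> included.\<close>

lemma crack_c_nonneg: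
  assumes "\<beta> \<in> {-1..0}" shows "0 \<le> crack_c \<beta>"
proof (cases "(\<lambda>s. sqrt (crack_w \<beta> s)) integrable_on {0..1}")
  case True
  have "0 \<le> crack_w \<beta> s" if s: "s \<in> {0..1}" for s
  proof -
    have "- \<beta> * (1 - s) \<le> 1 * 1" using assms s by (intro mult_mono) auto
    then show ?thesis using s by (auto simp: crack_w_def)
  qed
  then show ?thesis
    unfolding crack_c_def by (intro Henstock_Kurzweil_Integration.integral_nonneg True) auto
qed (simp add: crack_c_def not_integrable_integral)

lemma crack_density_nonneg:
  assumes "\<beta> \<in> {-1..0}" "l > 0" "d \<in> {0..1}" shows "0 \<le> crack_density \<beta> l d v"
proof -
  have "- \<beta> * (1 - d) \<le> 1 * 1" using assms by (intro mult_mono) auto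
  then have "0 \<le> crack_w \<beta> d" using assms(3) by (auto simp: crack_w_def)
  then show ?thesis
    unfolding crack_density_def using assms crack_c_nonneg[OF assms(1)]
    by (intro mult_nonneg_nonneg add_nonneg_nonneg) auto
qed

lemma crack_density_convex:
  assumes "\<beta> \<in> {-1..0}" "l > 0" and t: "0 \<le> t" "t \<le> 1"
  shows "crack_density \<beta> l ((1 - t) * a + t * b) ((1 - t) *\<^sub>R v + t *\<^sub>R w)
    \<le> (1 - t) * crack_density \<beta> l a v + t * crack_density \<beta> l b w"
proof -
  have w: "crack_w \<beta> s = (1 + \<beta>) * s + (- \<beta>) * s\<^sup>2" for s
    by (simp add: crack_w_def power2_eq_square algebra_simps)
  have "(- \<beta>) * ((1 - t) * a + t * b)\<^sup>2 \<le> (- \<beta>) * ((1 - t) * a\<^sup>2 + t * b\<^sup>2)"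
    using assms(1) by (intro mult_left_mono power2_convex_combination t) auto
  then have cw: "crack_w \<beta> ((1 - t) * a + t * b) \<le> (1 - t) * crack_w \<beta> a + t * crack_w \<beta> b"
    unfolding w by (simp add: algebra_simps)
  have "norm ((1 - t) *\<^sub>R v + t *\<^sub>R w) \<le> (1 - t) * norm v + t * norm w"
    using norm_triangle_ineq[of "(1 - t) *\<^sub>R v" "t *\<^sub>R w"] t by simp
  then have "(norm ((1 - t) *\<^sub>R v + t *\<^sub>R w))\<^sup>2 \<le> ((1 - t) * norm v + t * norm w)\<^sup>2"
    by (intro power_mono) auto
  also have "\<dots> \<le> (1 - t) * (norm v)\<^sup>2 + t * (norm w)\<^sup>2"
    by (rule power2_convex_combination[OF t])
  finally have n: "(norm ((1 - t) *\<^sub>R v + t *\<^sub>R w))\<^sup>2 \<le> (1 - t) * (norm v)\<^sup>2 + t * (norm w)\<^sup>2" .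
  have "crack_w \<beta> ((1 - t) * a + t * b) / l + l * (norm ((1 - t) *\<^sub>R v + t *\<^sub>R w))\<^sup>2
      \<le> ((1 - t) * crack_w \<beta> a + t * crack_w \<beta> b) / l + l * ((1 - t) * (norm v)\<^sup>2 + t * (norm w)\<^sup>2)"
    using cw n assms(2) by (intro add_mono divide_right_mono mult_left_mono) auto
  then have "1 / (4 * crack_c \<beta>) * (crack_w \<beta> ((1 - t) * a + t * b) / l + l * (norm ((1 - t) *\<^sub>R v + t *\<^sub>R w))\<^sup>2)
     \<le> 1 / (4 * crack_c \<beta>) * (((1 - t) * crack_w \<beta> a + t * crack_w \<beta> b) / l + l * ((1 - t) * (norm v)\<^sup>2 + t * (norm w)\<^sup>2))"
    using crack_c_nonneg[OF assms(1)] by (intro mult_left_mono) auto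
  also have "\<dots> = (1 - t) * crack_density \<beta> l a v + t * crack_density \<beta> l b w"
    unfolding crack_density_def divide_inverse[of _ l] by algebra
  finally show ?thesis unfolding crack_density_def .
qed

context lagrange_grid
begin

lemma open_domain: "open \<Omega>"
  using domain unfolding polyhedral_domain_def by (elim conjE)

lemma negligible_skeleton: "negligible (\<Union>e\<in>\<G>. frontier e)"
  using finite_grid element_simps(2) by (intro negligible_Union) (auto intro: negligible_convex_frontier)

lemma interior_element_subset:
  assumes "x \<in> \<Omega>" "x \<notin> (\<Union>e\<in>\<G>. frontier e)"
  obtains e where "e \<in> \<G>" "x \<in> interior e"
proof -
  have "x \<in> \<Union>\<G>" unfolding grid_cover using assms(1) by (rule subsetD[OF closure_subset])
  then obtain e where e: "e \<in> \<G>" "x \<in> e" by blast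
  then have "x \<in> interior e"
    using assms(2) element_simps(4)[OF e(1)] by (auto simp: frontier_def)
  with e that show thesis by blast
qed

lemma at_within_domain_eq_element:
  assumes "x \<in> \<Omega>" "x \<in> interior e"
  shows "at x within \<Omega> = at x within e"
  using at_within_open[OF assms(1) open_domain] at_within_interior[OF assms(2)] by simp

lemma gradient_fe_fun:
  fixes c :: "real^'n"
  assumes "e \<in> \<G>" "y \<in> e"
  shows "gradient e (fe_fun \<theta> c) y = (\<Sum>i\<in>UNIV. c $ i *\<^sub>R gradient e (\<theta> i) y)"
  unfolding gradient_eqI[OF element_simps(2)[OF assms(1)] element_interior[OF assms(1)] assms(2)
      fe_fun_has_derivative[OF assms]]
  by (simp add: vec_eq_iff inner_axis mult.commute)

text \<open>The gradient jumps across element boundaries, but these form a negligible set, and inside each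
  element the integrand agrees with a function that is continuous up to the boundary.\<close>

lemma crack_energy_integrable:
  fixes d :: "real^'n"
  shows "set_integrable lebesgue \<Omega> (\<lambda>x. gc * crack_density \<beta> l (fe_fun \<theta> d x) (gradient \<Omega> (fe_fun \<theta> d) x))"
    (is "set_integrable lebesgue \<Omega> ?f")
proof -
  note \<Omega> = open_domain
  have "set_integrable lebesgue (interior e \<inter> \<Omega>) ?f" if e: "e \<in> \<G>" for e
  proof -
    let ?h = "\<lambda>x. gc * crack_density \<beta> l (fe_fun \<theta> d x) (gradient e (fe_fun \<theta> d) x)"
    have "continuous_on e (gradient e (fe_fun \<theta> d))"
      using gradient_fe_fun[OF e] basis_gradient(2)[OF e]
      by (simp cong: continuous_on_cong) (intro continuous_intros)
    then have "continuous_on e ?h"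
      unfolding crack_density_def crack_w_def divide_inverse
      by (intro continuous_intros fe_fun_continuous_on e)
    then have "set_integrable lebesgue e ?h"
      by (intro set_integrable_continuous_compact element_simps(3) e)
    then have h: "set_integrable lebesgue (interior e \<inter> \<Omega>) ?h"
      by (rule set_integrable_subset) (use \<Omega> interior_subset in auto)
    have eq: "?f x = ?h x" if "x \<in> interior e \<inter> \<Omega>" for x
      using at_within_domain_eq_element[of x e] that by (simp add: gradient_def)
    show ?thesis
      by (rule absolutely_integrable_spike[OF h negligible_empty]) (rule eq, erule DiffD1)
  qed
  then have "set_integrable lebesgue (\<Union>e\<in>\<G>. interior e \<inter> \<Omega>) ?f"
    using finite_grid \<Omega> by (intro set_integrable_UN) auto
  moreover have "negligible {x \<in> \<Omega> - (\<Union>e\<in>\<G>. interior e \<inter> \<Omega>). ?f x \<noteq> 0}"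
  proof (rule negligible_subset[OF negligible_skeleton], rule subsetI)
    fix x assume x: "x \<in> {x \<in> \<Omega> - (\<Union>e\<in>\<G>. interior e \<inter> \<Omega>). ?f x \<noteq> 0}"
    show "x \<in> (\<Union>e\<in>\<G>. frontier e)"
    proof (rule ccontr)
      assume "x \<notin> (\<Union>e\<in>\<G>. frontier e)"
      then obtain e where "e \<in> \<G>" "x \<in> interior e" 
        using interior_element_subset[of x] x by blast
      then show False using x by blast
    qed
  qed
  moreover have "{x \<in> (\<Union>e\<in>\<G>. interior e \<inter> \<Omega>) - \<Omega>. ?f x \<noteq> 0} = {}"
    by (rule Collect_empty_eq[THEN iffD2]) blast
  moreover from this have "negligible {x \<in> (\<Union>e\<in>\<G>. interior e \<inter> \<Omega>) - \<Omega>. ?f x \<noteq> 0}"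
    by (simp only: negligible_empty)
  ultimately show ?thesis
    using absolutely_integrable_spike_set_eq[of \<Omega> "\<Union>e\<in>\<G>. interior e \<inter> \<Omega>" ?f] by blast
qed

text \<open>This holds for all nodal damages, not only for those in the box; hence the crack energy
  is continuous as a finite convex function.\<close>

lemma convex_on_crack_energy:
  assumes "\<beta> \<in> {-1..0}" "l > 0" "gc > 0"
  shows "convex_on UNIV (\<lambda>d :: real^'n. crack_energy \<Omega> \<theta> gc \<beta> l d)"
proof (rule convex_onI)
  fix t :: real and a b :: "real^'n" assume t: "0 < t" "t < 1"
  let ?f = "\<lambda>d x. gc * crack_density \<beta> l (fe_fun \<theta> d x) (gradient \<Omega> (fe_fun \<theta> d) x)"
  let ?c = "(1 - t) *\<^sub>R a + t *\<^sub>R b"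
  have "?f ?c x \<le> (1 - t) * ?f a x + t * ?f b x"
    if x: "x \<in> \<Omega>" "x \<notin> (\<Union>e\<in>\<G>. frontier e)" for x
  proof -
    obtain e where e: "e \<in> \<G>" "x \<in> interior e" using interior_element_subset[OF x] .
    have "x \<in> e" using e(2) interior_subset[of e] by (rule set_rev_mp)
    have "gradient \<Omega> v x = gradient e v x" for v
      using at_within_domain_eq_element[OF x(1) e(2)] by (simp add: gradient_def)
    then have "gradient \<Omega> (fe_fun \<theta> ?c) x = (1 - t) *\<^sub>R gradient \<Omega> (fe_fun \<theta> a) x + t *\<^sub>R gradient \<Omega> (fe_fun \<theta> b) x"
      by (simp add: gradient_fe_fun[OF e(1) \<open>x \<in> e\<close>] scaleR_sum_right sum.distrib scaleR_left_distrib)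
    moreover have "fe_fun \<theta> ?c x = (1 - t) * fe_fun \<theta> a x + t * fe_fun \<theta> b x"
      by (simp add: linear_add[OF fe_fun_linear] linear_scale[OF fe_fun_linear])
    ultimately have "crack_density \<beta> l (fe_fun \<theta> ?c x) (gradient \<Omega> (fe_fun \<theta> ?c) x)
      \<le> (1 - t) * crack_density \<beta> l (fe_fun \<theta> a x) (gradient \<Omega> (fe_fun \<theta> a) x)
        + t * crack_density \<beta> l (fe_fun \<theta> b x) (gradient \<Omega> (fe_fun \<theta> b) x)"
      using crack_density_convex[OF assms(1,2), of t] t by simp
    then have "gc * crack_density \<beta> l (fe_fun \<theta> ?c x) (gradient \<Omega> (fe_fun \<theta> ?c) x)
      \<le> gc * ((1 - t) * crack_density \<beta> l (fe_fun \<theta> a x) (gradient \<Omega> (fe_fun \<theta> a) x)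
        + t * crack_density \<beta> l (fe_fun \<theta> b x) (gradient \<Omega> (fe_fun \<theta> b) x))"
      using assms(3) by (intro mult_left_mono) auto
    then show ?thesis by (simp add: distrib_left mult.left_commute)
  qed
  moreover have "AE x in lebesgue. x \<notin> (\<Union>e\<in>\<G>. frontier e)"
    using negligible_skeleton by (intro AE_not_in) (simp add: negligible_iff_null_sets)
  ultimately have ae: "AE x\<in>\<Omega> in lebesgue. ?f ?c x \<le> (1 - t) * ?f a x + t * ?f b x"
    by (auto elim!: eventually_mono)
  note int = crack_energy_integrable[of gc \<beta> l]
  have "(LINT x:\<Omega>|lebesgue. ?f ?c x) \<le> (LINT x:\<Omega>|lebesgue. (1 - t) * ?f a x + t * ?f b x)"
    by (intro set_integral_mono_AE ae int set_integral_add set_integrable_mult_right)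
  also have "\<dots> = (1 - t) * (LINT x:\<Omega>|lebesgue. ?f a x) + t * (LINT x:\<Omega>|lebesgue. ?f b x)"
    by (subst set_integral_add) (auto intro: int)
  finally show "crack_energy \<Omega> \<theta> gc \<beta> l ?c \<le> (1 - t) * crack_energy \<Omega> \<theta> gc \<beta> l a + t * crack_energy \<Omega> \<theta> gc \<beta> l b"
    by (simp add: crack_energy_def)
qed simp

lemma crack_energy_nonneg:
  assumes "\<beta> \<in> {-1..0}" "l > 0" "gc > 0" and d: "(d :: real^'n) \<in> cbox 0 1"
  shows "0 \<le> crack_energy \<Omega> \<theta> gc \<beta> l d"
  unfolding crack_energy_def set_lebesgue_integral_def
proof (rule Bochner_Integration.integral_nonneg)
  fix x
  have "0 \<le> gc * crack_density \<beta> l (fe_fun \<theta> d x) (gradient \<Omega> (fe_fun \<theta> d) x)" if "x \<in> \<Omega>"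
  proof -
    have "x \<in> \<Union>\<G>" unfolding grid_cover using that by (rule subsetD[OF closure_subset])
    then obtain e where "e \<in> \<G>" "x \<in> e" by blast
    then have "fe_fun \<theta> d x \<in> {0..1}" using d by (intro fe_fun_unit_interval) (auto simp: mem_damage_box)
    then show ?thesis
      using assms by (intro mult_nonneg_nonneg crack_density_nonneg) auto
  qed
  then show "0 \<le> indicator \<Omega> x *\<^sub>R (gc * crack_density \<beta> l (fe_fun \<theta> d x) (gradient \<Omega> (fe_fun \<theta> d) x))"
    by (auto split: split_indicator)
qed

lemma bulk_energy_convex_u:
  assumes q: "\<And>e \<alpha>. e \<in> \<G> \<Longrightarrow> \<alpha> \<in> {1..amax} \<Longrightarrow> q e \<alpha> \<in> e \<and> \<omega> e \<alpha> > 0"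
    and g: "g ` {0..1} \<subseteq> {0..1}" "k > 0"
    and \<psi>: "convex_on sym_matrices \<psi>p" "convex_on sym_matrices \<psi>m"
    and d: "(d :: real^'n) \<in> cbox 0 1"
  shows "convex_on UNIV (\<lambda>u. bulk_energy \<G> \<theta> amax q \<omega> (psi g k \<psi>p \<psi>m) u d)"
  unfolding bulk_energy_def quad_sum_def psi_def
proof (intro convex_on_finite_sum finite_grid finite_atLeastAtMost convex_UNIV)
  fix e \<alpha> assume e: "e \<in> \<G>" "\<alpha> \<in> {1..amax}"
  let ?E = "\<lambda>u :: real^'m^'n. strain e (fe_fun \<theta> u) (q e \<alpha>)"
  have "fe_fun \<theta> d (q e \<alpha>) \<in> {0..1}"
    using d q[OF e] e(1) by (intro fe_fun_unit_interval) (auto simp: mem_damage_box)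
  then have gd: "0 \<le> g (fe_fun \<theta> d (q e \<alpha>)) + k" using g by (force simp: image_subset_iff)
  have "linear ?E" using q[OF e] e(1) by (intro linear_strain) auto
  then have "convex_on UNIV (\<lambda>u. \<psi>p (?E u))" "convex_on UNIV (\<lambda>u. \<psi>m (?E u))"
    by (intro convex_on_compose_linear[OF _ \<psi>(1)] convex_on_compose_linear[OF _ \<psi>(2)] strain_sym convex_UNIV; assumption)+
  then have "convex_on UNIV (\<lambda>u. \<omega> e \<alpha> * ((g (fe_fun \<theta> d (q e \<alpha>)) + k) * \<psi>p (?E u) + (1 + k) * \<psi>m (?E u)))"
    using gd g(2) q[OF e] by (intro convex_on_cmul convex_on_add) auto
  then show "convex_on UNIV (\<lambda>u. ((g (fe_fun \<theta> d (q e \<alpha>)) + k) * \<psi>p (?E u) + (1 + k) * \<psi>m (?E u)) * \<omega> e \<alpha>)"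
    by (simp add: mult.commute)
qed

lemma bulk_energy_convex_d:
  assumes q: "\<And>e \<alpha>. e \<in> \<G> \<Longrightarrow> \<alpha> \<in> {1..amax} \<Longrightarrow> q e \<alpha> \<in> e \<and> \<omega> e \<alpha> > 0"
    and g: "convex_on {0..1} g"
    and \<psi>: "\<And>E. E \<in> sym_matrices \<Longrightarrow> 0 \<le> \<psi>p E"
  shows "convex_on (cbox 0 1 :: (real^'n) set) (\<lambda>d. bulk_energy \<G> \<theta> amax q \<omega> (psi g k \<psi>p \<psi>m) u d)"
  unfolding bulk_energy_def quad_sum_def psi_def
proof (intro convex_on_finite_sum finite_grid finite_atLeastAtMost convex_box)
  fix e \<alpha> assume e: "e \<in> \<G>" "\<alpha> \<in> {1..amax}"
  let ?E = "strain e (fe_fun \<theta> u) (q e \<alpha>)"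
  have "convex_on (cbox 0 1) (\<lambda>d :: real^'n. g (fe_fun \<theta> d (q e \<alpha>)))"
    by (rule convex_on_compose_linear[OF fe_fun_linear g convex_box(1)], rule fe_fun_unit_interval)
      (use q[OF e] e(1) in \<open>auto simp: mem_damage_box\<close>)
  then have "convex_on (cbox 0 1) (\<lambda>d :: real^'n. (\<omega> e \<alpha> * \<psi>p ?E) * g (fe_fun \<theta> d (q e \<alpha>)))"
    using q[OF e] \<psi>[OF strain_sym] by (intro convex_on_cmul mult_nonneg_nonneg) auto
  moreover have "convex_on (cbox 0 1) (\<lambda>d :: real^'n. \<omega> e \<alpha> * (k * \<psi>p ?E + (1 + k) * \<psi>m ?E))"
    by (simp add: convex_on_const)
  ultimately have "convex_on (cbox 0 1) (\<lambda>d :: real^'n. (\<omega> e \<alpha> * \<psi>p ?E) * g (fe_fun \<theta> d (q e \<alpha>)) + \<omega> e \<alpha> * (k * \<psi>p ?E + (1 + k) * \<psi>m ?E))"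
    by (rule convex_on_add)
  then show "convex_on (cbox 0 1) (\<lambda>d :: real^'n. ((g (fe_fun \<theta> d (q e \<alpha>)) + k) * \<psi>p ?E + (1 + k) * \<psi>m ?E) * \<omega> e \<alpha>)"
    by (simp add: algebra_simps)
qed

lemma bulk_energy_continuous:
  assumes q: "\<And>e \<alpha>. e \<in> \<G> \<Longrightarrow> \<alpha> \<in> {1..amax} \<Longrightarrow> q e \<alpha> \<in> e \<and> \<omega> e \<alpha> > 0"
    and g: "continuous_on {0..1} g"
    and \<psi>: "convex_on sym_matrices \<psi>p" "convex_on sym_matrices \<psi>m"
  shows "continuous_on (UNIV \<times> (cbox 0 1 :: (real^'n) set))
    (\<lambda>x. bulk_energy \<G> \<theta> amax q \<omega> (psi g k \<psi>p \<psi>m) (fst x) (snd x))"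
  unfolding bulk_energy_def quad_sum_def psi_def
proof (intro continuous_on_sum continuous_on_mult continuous_on_add continuous_on_const)
  fix e \<alpha> assume e: "e \<in> \<G>" "\<alpha> \<in> {1..amax}"
  let ?S = "UNIV \<times> (cbox 0 1 :: (real^'n) set)"
  let ?E = "\<lambda>x :: (real^'m^'n) \<times> (real^'n). strain e (fe_fun \<theta> (fst x)) (q e \<alpha>)"
  have "linear (\<lambda>u :: real^'m^'n. strain e (fe_fun \<theta> u) (q e \<alpha>))"
    using q[OF e] e(1) by (intro linear_strain) auto
  then have "continuous_on UNIV (\<lambda>u :: real^'m^'n. strain e (fe_fun \<theta> u) (q e \<alpha>))"
    by (intro linear_continuous_on) (simp add: linear_conv_bounded_linear)
  from continuous_on_compose2[OF this continuous_on_fst[OF continuous_on_id]]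
  have E: "continuous_on ?S ?E" by simp
  have "continuous_on ?S (\<lambda>x. f (?E x))" if f: "convex_on sym_matrices f" for f
    using continuous_on_compose2[OF continuous_on_convex_sym_part[OF f, of UNIV] E]
    by (simp add: sym_part_sym[OF strain_sym])
  then show "continuous_on ?S (\<lambda>x. \<psi>p (?E x))" "continuous_on ?S (\<lambda>x. \<psi>m (?E x))" using \<psi> by blast+
  have "continuous_on ?S (\<lambda>x. fe_fun \<theta> (snd x) (q e \<alpha>))"
    unfolding fe_fun_def by (intro continuous_intros)
  moreover have "fe_fun \<theta> (snd x) (q e \<alpha>) \<in> {0..1}" if "x \<in> ?S" for x
    using that q[OF e] e(1) by (intro fe_fun_unit_interval) (auto simp: mem_damage_box mem_Times_iff)
  ultimately show "continuous_on ?S (\<lambda>x. g (fe_fun \<theta> (snd x) (q e \<alpha>)))"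
    by (intro continuous_on_compose2[OF g]) auto
qed

text \<open>As \<open>g \<ge> 0\<close>, the coefficients of both parts of the split are at least \<open>k\<close>.\<close>

lemma bulk_energy_lower_bound:
  assumes q: "\<And>e \<alpha>. e \<in> \<G> \<Longrightarrow> \<alpha> \<in> {1..amax} \<Longrightarrow> q e \<alpha> \<in> e \<and> \<omega> e \<alpha> > 0"
    and g: "g ` {0..1} \<subseteq> {0..1}" "k > 0"
    and \<psi>: "\<And>E. E \<in> sym_matrices \<Longrightarrow> 0 \<le> \<psi>p E" "\<And>E. E \<in> sym_matrices \<Longrightarrow> 0 \<le> \<psi>m E"
      "\<And>E. E \<in> sym_matrices \<Longrightarrow> c * (norm E)\<^sup>2 \<le> \<psi>p E + \<psi>m E"
    and d: "(d :: real^'n) \<in> cbox 0 1"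
  shows "k * c * discrete_strain_energy amax q \<omega> u \<le> bulk_energy \<G> \<theta> amax q \<omega> (psi g k \<psi>p \<psi>m) u d"
  unfolding bulk_energy_def quad_sum_def discrete_strain_energy_def sum_distrib_left
proof (intro sum_mono)
  fix e \<alpha> assume e: "e \<in> \<G>" "\<alpha> \<in> {1..amax}"
  let ?E = "strain e (fe_fun \<theta> u) (q e \<alpha>)"
  let ?g = "g (fe_fun \<theta> d (q e \<alpha>))"
  have "fe_fun \<theta> d (q e \<alpha>) \<in> {0..1}"
    using d q[OF e] e(1) by (intro fe_fun_unit_interval) (auto simp: mem_damage_box)
  then have gd: "0 \<le> ?g" using g by (force simp: image_subset_iff)
  note \<psi>E = \<psi>[OF strain_sym, of e "fe_fun \<theta> u" "q e \<alpha>"]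
  have "k * (c * (norm ?E)\<^sup>2) \<le> k * (\<psi>p ?E + \<psi>m ?E)"
    using \<psi>E(3) g(2) by (intro mult_left_mono) auto
  moreover have "0 \<le> ?g * \<psi>p ?E" using gd \<psi>E(1) by simp
  ultimately have "k * (c * (norm ?E)\<^sup>2) \<le> psi g k \<psi>p \<psi>m ?E (fe_fun \<theta> d (q e \<alpha>))"
    using \<psi>E(2) unfolding psi_def distrib_left distrib_right by linarith
  then have "k * (c * (norm ?E)\<^sup>2) * \<omega> e \<alpha> \<le> psi g k \<psi>p \<psi>m ?E (fe_fun \<theta> d (q e \<alpha>)) * \<omega> e \<alpha>"
    using q[OF e] by (intro mult_right_mono) auto
  then show "k * c * ((norm ?E)\<^sup>2 * \<omega> e \<alpha>) \<le> psi g k \<psi>p \<psi>m ?E (fe_fun \<theta> d (q e \<alpha>)) * \<omega> e \<alpha>"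
    by (simp add: mult.assoc)
qed

end

section \<open>The energy functional\<close>

text \<open>Off the closed set the function is locally constant with value \<open>\<infinity>\<close>; at points of the set
  approaching from outside does not lower the limit.\<close>

lemma lsc_on_restricted:
  assumes C: "closed C" and f: "continuous_on C f"
  shows "lsc_on S (\<lambda>x. if x \<in> C then ereal (f x) else \<infinity>)"
  unfolding lsc_on_def
proof
  fix x assume "x \<in> S"
  let ?F = "\<lambda>x. if x \<in> C then ereal (f x) else \<infinity>"
  show "?F x \<le> Liminf (at x within S) ?F"
    unfolding le_Liminf_iff
  proof (intro allI impI)
    fix y assume y: "y < ?F x"
    show "eventually (\<lambda>x. y < ?F x) (at x within S)"
    proof (cases "x \<in> C")
      case False
      have "eventually (\<lambda>z. z \<in> - C) (at x within S)"
        using C False by (intro eventually_at_topological[THEN iffD2] exI[of _ "- C"]) auto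
      then show ?thesis
        by (rule eventually_mono) (use y False in auto)
    next
      case True
      have "eventually (\<lambda>z. z \<in> C \<longrightarrow> y < ereal (f z)) (nhds x)"
      proof -
        have "openin (top_of_set C) (C \<inter> f -` {r. y < ereal r})"
        proof (rule continuous_openin_preimage_gen[OF f])
          show "open {r. y < ereal r}"
            by (intro open_Collect_less continuous_intros)
        qed
        then obtain U where U: "open U" "C \<inter> f -` {r. y < ereal r} = C \<inter> U" by (auto simp: openin_open)
        have "x \<in> U" using U(2) True y by auto
        then show ?thesis using U by (auto simp: eventually_nhds)
      qed
      then have "eventually (\<lambda>z. z \<in> C \<longrightarrow> y < ereal (f z)) (at x within S)"
        by (auto simp: eventually_at_filter elim: eventually_mono)
      then show ?thesis
        by (rule eventually_mono) (use y in auto)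
    qed
  qed
qed

lemma ereal_convex_on_restricted:
  assumes "convex_on C f"
  shows "ereal_convex_on UNIV (\<lambda>x. if x \<in> C then ereal (f x) else \<infinity>)"
  unfolding ereal_convex_on_def
proof (intro conjI ballI convex_UNIV)
  fix x y and t :: real assume t: "t \<in> {0<..<1}"
  let ?F = "\<lambda>x. if x \<in> C then ereal (f x) else \<infinity>"
  show "?F ((1 - t) *\<^sub>R x + t *\<^sub>R y) \<le> ereal (1 - t) * ?F x + ereal t * ?F y"
  proof (cases "x \<in> C \<and> y \<in> C")
    case True
    moreover have "(1 - t) *\<^sub>R x + t *\<^sub>R y \<in> C"
      using True assms t by (auto simp: convex_on_def convex_def)
    ultimately show ?thesis using assms t by (simp add: convex_on_def)
  next
    case False
    then have infinite: "ereal (1 - t) * ?F x + ereal t * ?F y = \<infinity>" using t by auto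
    show ?thesis unfolding infinite by (rule ereal_less_eq(1))
  qed
qed

lemma irreversibility_eq:
  fixes dn d :: "real^'n"
  shows "irreversibility dn d = (if d \<in> cbox dn 1 then 0 else \<infinity>)"
proof (cases "d \<in> cbox dn 1")
  case True
  then have "irreversibility dn d = (\<Sum>i\<in>(UNIV :: 'n set). 0)"
    unfolding irreversibility_def by (intro sum.cong refl) (auto simp: ind_ext_def mem_damage_box)
  then show ?thesis using True by simp
next
  case False
  then obtain i where "d $ i \<notin> {dn $ i..1}" unfolding mem_damage_box by blast
  then have "irreversibility dn d = \<infinity>"
    unfolding irreversibility_def sum_Pinfty by (intro conjI finite bexI[of _ i]) (auto simp: ind_ext_def)
  then show ?thesis using False by simp
qed

lemma quadratic_dominates:
  fixes a K C r :: real
  assumes "a > 0"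
  obtains R where "\<And>s. s \<ge> R \<Longrightarrow> r < a * s\<^sup>2 - K * s - C"
proof
  let ?M = "\<bar>K\<bar> + \<bar>C\<bar> + \<bar>r\<bar> + 1"
  fix s assume s: "max 1 (?M / a) \<le> s"
  then have "?M \<le> a * s" using assms by (simp add: field_simps)
  then have "?M * s \<le> a * s * s" using s by (intro mult_right_mono) auto
  moreover have "K * s \<le> \<bar>K\<bar> * s" "\<bar>C\<bar> + \<bar>r\<bar> + 1 \<le> (\<bar>C\<bar> + \<bar>r\<bar> + 1) * s"
    using s by (auto intro!: mult_right_mono) (simp add: mult_le_cancel_left1)
  ultimately show "r < a * s\<^sup>2 - K * s - C"
    by (simp add: power2_eq_square algebra_simps)
qed

lemma norm_diff_power2_le: "(norm (a - b))\<^sup>2 \<le> 2 * (norm a)\<^sup>2 + 2 * (norm b)\<^sup>2" for a b :: "'a::real_inner"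
proof -
  have "0 \<le> (norm (a + b))\<^sup>2" by simp
  then show ?thesis by (simp add: power2_norm_eq_inner inner_simps inner_commute algebra_simps)
qed

theorem lemma3p5:
  fixes mu lam k gc l \<beta> :: real
    and g :: "real \<Rightarrow> real"
    and \<psi>p \<psi>m :: "real^'m^'m \<Rightarrow> real"
    and \<Omega> \<Gamma>u \<Gamma>d :: "(real^'m) set"
    and \<G> :: "(real^'m) set set"
    and \<B> :: "(real^'m) set \<Rightarrow> 'm set set"
    and F :: "(real^'m) set \<Rightarrow> real^'m \<Rightarrow> real^'m"
    and p :: "'n::finite \<Rightarrow> real^'m"
    and \<theta> :: "'n \<Rightarrow> real^'m \<Rightarrow> real"
    and amax :: nat
    and q :: "(real^'m) set \<Rightarrow> nat \<Rightarrow> real^'m"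
    and \<omega> :: "(real^'m) set \<Rightarrow> nat \<Rightarrow> real"
    and Pext :: "real^'m^'n \<Rightarrow> real"
    and u0 :: "real^'m \<Rightarrow> real^'m"
    and d0 :: "real^'m \<Rightarrow> real"
    and dn :: "real^'n"
    and J0 :: "(real^'m^'n) \<times> (real^'n) \<Rightarrow> real"
    and J :: "(real^'m^'n) \<times> (real^'n) \<Rightarrow> ereal"
  assumes material: "mu > 0" "lam > - 2/3 * mu"
      "strongly_convex_on (sym_matrices :: (real^'m^'m) set) (psi0 mu lam)"
    and degradation: "degradation_function g" "k > 0"
    and split: "energy_split mu lam \<psi>p \<psi>m"
    and crack: "l > 0" "\<beta> \<in> {-1..0}" "gc > 0"
    and domain: "polyhedral_domain \<Omega>"
    and grid: "conforming_grid \<Omega> \<G> \<B> F"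
    and basis: "lagrange_nodal_basis \<Omega> \<G> \<B> F p \<theta>"
    and quadrature: "admissible_quadrature \<G> \<theta> amax q \<omega>"
    and external: "linear Pext"
    and dirichlet: "\<Gamma>u \<subseteq> frontier \<Omega>" "\<Gamma>d \<subseteq> frontier \<Omega>"
      "\<exists>f. boundary_grid_face \<Omega> \<G> f \<and> vertices f \<subseteq> grid_nodes \<G> \<inter> \<Gamma>u"
    and previous_damage: "\<forall>i. dn $ i \<in> {0..1}" "\<forall>i. p i \<in> \<Gamma>d \<longrightarrow> dn $ i = d0 (p i)"
    and J0_def: "\<forall>u d. J0 (u, d) = bulk_energy \<G> \<theta> amax q \<omega> (psi g k \<psi>p \<psi>m) u d
        + crack_energy \<Omega> \<theta> gc \<beta> l d + Pext u"
    and J_def: "\<forall>u d. J (u, d) = ereal (J0 (u, d)) + irreversibility dn d"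
  shows "proper_on (H_alg p \<Gamma>u \<Gamma>d u0 d0) J \<and>
         lsc_on (H_alg p \<Gamma>u \<Gamma>d u0 d0) J \<and>
         coercive_on (H_alg p \<Gamma>u \<Gamma>d u0 d0) J \<and>
         (\<forall>d. ereal_convex_on UNIV (\<lambda>u. J (u, d))) \<and>
         (\<forall>u. ereal_convex_on UNIV (\<lambda>d. J (u, d)))"
proof -
  interpret lagrange_grid \<Omega> \<G> \<B> F p \<theta>
    using domain grid basis by (rule lagrange_grid.intro)
  let ?H = "H_alg p \<Gamma>u \<Gamma>d u0 d0"
  let ?D = "cbox dn 1"
  let ?bulk = "bulk_energy \<G> \<theta> amax q \<omega> (psi g k \<psi>p \<psi>m)"
  let ?crack = "crack_energy \<Omega> \<theta> gc \<beta> l"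
  let ?Q = "discrete_strain_energy amax q \<omega>"
  note \<psi> = energy_split_properties[OF material(1,3) split]
  have q: "q e \<alpha> \<in> e \<and> \<omega> e \<alpha> > 0" if "e \<in> \<G>" "\<alpha> \<in> {1..amax}" for e \<alpha>
    using quadrature that unfolding admissible_quadrature_def by blast
  have g: "g ` {0..1} \<subseteq> {0..1}" "convex_on {0..1} g"
    using degradation(1) unfolding degradation_function_def by blast+
  note g_cont = degradation_continuous[OF degradation(1)]
  have D01: "?D \<subseteq> cbox 0 1"
  proof
    fix d assume "d \<in> ?D"
    then have "dn $ i \<le> d $ i \<and> d $ i \<le> 1" "0 \<le> dn $ i" for i
      using previous_damage(1) by (simp_all add: mem_damage_box)
    then show "d \<in> cbox 0 1" unfolding mem_damage_box by (auto intro: order_trans)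
  qed
  have J: "J x = (if x \<in> UNIV \<times> ?D then ereal (J0 x) else \<infinity>)" for x
    using J_def by (cases x) (simp add: irreversibility_eq)

  have proper: "proper_on ?H J"
    unfolding proper_on_def
  proof (intro conjI ballI bexI)
    show "((\<chi> i. u0 (p i)), dn) \<in> ?H" using previous_damage(2) by (simp add: H_alg_def)
    show "J ((\<chi> i. u0 (p i)), dn) \<noteq> \<infinity>"
      using previous_damage(1) by (simp add: J mem_damage_box)
    show "J x \<noteq> - \<infinity>" for x by (simp add: J)
  qed

  have crack_convex: "convex_on UNIV (\<lambda>d :: real^'n. ?crack d)"
    by (rule convex_on_crack_energy[OF crack(2,1,3)])
  have Pext_bounded: "bounded_linear Pext" using external by (simp add: linear_conv_bounded_linear)
  have J0_eq: "J0 = (\<lambda>x. ?bulk (fst x) (snd x) + ?crack (snd x) + Pext (fst x))"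
    using J0_def by auto
  have "continuous_on (UNIV \<times> cbox 0 1) J0"
    unfolding J0_eq
  proof (intro continuous_on_add bulk_energy_continuous q g_cont \<psi>(1,2))
    show "continuous_on (UNIV \<times> cbox 0 1) (\<lambda>x :: (real^'m^'n) \<times> (real^'n). ?crack (snd x))"
      by (rule continuous_on_compose2[OF convex_on_continuous[OF open_UNIV crack_convex]])
        (auto intro: continuous_intros)
    show "continuous_on (UNIV \<times> cbox 0 1) (\<lambda>x :: (real^'m^'n) \<times> (real^'n). Pext (fst x))"
      by (rule bounded_linear.continuous_on[OF Pext_bounded]) (intro continuous_intros)
  qed
  then have "continuous_on (UNIV \<times> ?D) J0" by (rule continuous_on_subset) (use D01 in auto)
  moreover have "closed (UNIV \<times> ?D :: ((real^'m^'n) \<times> (real^'n)) set)"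
    by (intro closed_Times closed_UNIV closed_cbox)
  ultimately have lsc: "lsc_on ?H J"
    using lsc_on_restricted[of "UNIV \<times> ?D" J0 ?H] J by presburger

  have convex_u: "ereal_convex_on UNIV (\<lambda>u. J (u, d))" for d
  proof -
    \<comment> \<open>For an inadmissible damage the functional is constantly \<open>\<infinity>\<close>.\<close>
    let ?C = "if d \<in> ?D then UNIV else {} :: (real^'m^'n) set"
    have "convex_on ?C (\<lambda>u. J0 (u, d))"
    proof (cases "d \<in> ?D")
      case True
      have "convex_on UNIV (\<lambda>u. ?bulk u d + (?crack d + Pext u))"
      proof (rule convex_on_add)
        show "convex_on UNIV (\<lambda>u. ?bulk u d)"
          using True D01 by (intro bulk_energy_convex_u q g \<psi> degradation) auto
        show "convex_on UNIV (\<lambda>u. ?crack d + Pext u)"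
          unfolding convex_on_def
          by (auto simp: linear_add[OF external] linear_scale[OF external] algebra_simps)
            (metis distrib_right mult.commute mult_1 order_refl)
      qed
      then show ?thesis using True by (simp add: J0_eq add.assoc)
    qed (simp add: convex_on_def)
    from ereal_convex_on_restricted[OF this] show ?thesis by (cases "d \<in> ?D") (simp_all add: J)
  qed

  have convex_d: "ereal_convex_on UNIV (\<lambda>d. J (u, d))" for u
  proof -
    have "convex_on (cbox 0 1) (\<lambda>d. ?bulk u d)"
      by (intro bulk_energy_convex_d q g \<psi>)
    then have "convex_on ?D (\<lambda>d. ?bulk u d)"
      using D01 convex_on_subset convex_box(1) by blast
    moreover have "convex_on ?D (\<lambda>d. ?crack d)"
      using convex_on_subset[OF crack_convex] convex_box(1) by blast
    ultimately have "convex_on ?D (\<lambda>d. (?bulk u d + ?crack d) + Pext u)"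
      by (intro convex_on_add) (simp_all add: convex_on_const)
    then have "convex_on ?D (\<lambda>d. J0 (u, d))" by (simp add: J0_eq)
    from ereal_convex_on_restricted[OF this] show ?thesis by (simp add: J)
  qed

  have coercive: "coercive_on ?H J"
  proof -
    obtain c where c: "c > 0" "\<And>E. E \<in> (sym_matrices :: (real^'m^'m) set) \<Longrightarrow> c * (norm E)\<^sup>2 \<le> psi0 mu lam E"
      using psi0_coercive[OF material(3)] by blast
    have energy: "c * (norm E)\<^sup>2 \<le> \<psi>p E + \<psi>m E" if "E \<in> sym_matrices" for E
      using c(2)[OF that] \<psi>(5)[OF that] by linarith
    obtain \<kappa> where \<kappa>: "\<kappa> > 0"
      "\<And>u. (\<And>i. p i \<in> \<Gamma>u \<Longrightarrow> u $ i = 0) \<Longrightarrow> \<kappa> * (norm u)\<^sup>2 \<le> ?Q u"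
      using discrete_korn[OF dirichlet(3) quadrature] by blast
    obtain K where K: "\<And>u. norm (Pext u) \<le> norm u * K" using bounded_linear.bounded[OF Pext_bounded] by blast
    \<comment> \<open>Admissible displacements differ from \<open>ub\<close> by a displacement with homogeneous boundary values.\<close>
    define ub where "ub = (\<chi> i. u0 (p i))"
    define a where "a = k * c * \<kappa> / 2"
    have a: "a > 0" using c(1) \<kappa>(1) degradation(2) by (simp add: a_def)
    define C where "C = k * c * ?Q ub - Pext ub"
    have lower: "a * (norm (u - ub))\<^sup>2 - K * norm (u - ub) - C \<le> J0 (u, d)"
      if x: "(u, d) \<in> ?H" and d: "d \<in> ?D" for u d
    proof -
      have d01: "d \<in> cbox 0 1" using d D01 by blast
      have "?Q (u - ub) \<le> 2 * ?Q u + 2 * ?Q ub"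
        unfolding discrete_strain_energy_def sum_distrib_left sum.distrib[symmetric]
      proof (intro sum_mono)
        fix e \<alpha> assume e: "e \<in> \<G>" "\<alpha> \<in> {1..amax}"
        let ?E = "\<lambda>u :: real^'m^'n. strain e (fe_fun \<theta> u) (q e \<alpha>)"
        have "?E (u - ub) = ?E u - ?E ub"
          using q[OF e] e(1) by (intro linear_diff linear_strain) auto
        then have "(norm (?E (u - ub)))\<^sup>2 * \<omega> e \<alpha> \<le> (2 * (norm (?E u))\<^sup>2 + 2 * (norm (?E ub))\<^sup>2) * \<omega> e \<alpha>"
          using q[OF e] norm_diff_power2_le[of "?E u" "?E ub"] by (intro mult_right_mono) auto
        then show "(norm (?E (u - ub)))\<^sup>2 * \<omega> e \<alpha> \<le> 2 * ((norm (?E u))\<^sup>2 * \<omega> e \<alpha>) + 2 * ((norm (?E ub))\<^sup>2 * \<omega> e \<alpha>)"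
          by (simp add: algebra_simps)
      qed
      moreover have "\<kappa> * (norm (u - ub))\<^sup>2 \<le> ?Q (u - ub)"
        using x by (intro \<kappa>(2)) (auto simp: H_alg_def ub_def)
      ultimately have "\<kappa> / 2 * (norm (u - ub))\<^sup>2 - ?Q ub \<le> ?Q u" by linarith
      then have "k * c * (\<kappa> / 2 * (norm (u - ub))\<^sup>2 - ?Q ub) \<le> k * c * ?Q u"
        using c(1) degradation(2) by (intro mult_left_mono) auto
      also have "\<dots> \<le> ?bulk u d"
        by (intro bulk_energy_lower_bound q g degradation \<psi> d01 energy)
      finally have "a * (norm (u - ub))\<^sup>2 - k * c * ?Q ub \<le> ?bulk u d"
        by (simp add: a_def algebra_simps)
      moreover have "0 \<le> ?crack d" by (rule crack_energy_nonneg[OF crack(2,1,3) d01])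
      moreover have "- (K * norm (u - ub)) + Pext ub \<le> Pext u"
        using K[of "u - ub"] by (simp add: linear_diff[OF external] mult.commute abs_le_iff)
      ultimately show ?thesis by (simp add: J0_eq C_def)
    qed
    show ?thesis
      unfolding coercive_on_def tendsto_PInfty eventually_inf_principal eventually_at_infinity
    proof
      fix r :: real
      obtain R where R: "\<And>s. s \<ge> R \<Longrightarrow> r < a * s\<^sup>2 - K * s - C"
        using quadratic_dominates[OF a] by blast
      show "\<exists>b. \<forall>x. b \<le> norm x \<longrightarrow> x \<in> ?H \<longrightarrow> ereal r < J x"
      proof (intro exI allI impI)
        fix x :: "(real^'m^'n) \<times> (real^'n)"
        assume b: "R + norm ub + real CARD('n) \<le> norm x" and x: "x \<in> ?H"
        obtain u d where ud: "x = (u, d)" by (cases x)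
        show "ereal r < J x"
        proof (cases "d \<in> ?D")
          case True
          have "d \<in> cbox 0 1" using True D01 by blast
          then have "\<bar>d $ i\<bar> \<le> 1" for i by (auto simp: mem_damage_box)
          then have "(\<Sum>i\<in>UNIV. \<bar>d $ i\<bar>) \<le> (\<Sum>i\<in>(UNIV :: 'n set). 1)" by (intro sum_mono) auto
          then have "norm d \<le> real CARD('n)" using norm_le_l1_cart[of d] by simp
          moreover have "norm x \<le> norm u + norm d" unfolding ud by (rule norm_Pair_le)
          moreover have "norm u \<le> norm (u - ub) + norm ub" using norm_triangle_ineq[of "u - ub" ub] by simp
          ultimately have "R \<le> norm (u - ub)" using b by linarith
          then have "r < J0 (u, d)" using R lower[of u d] x True ud by (meson less_le_trans)
          then show ?thesis using True by (simp add: J ud)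
        qed (simp add: J ud)
      qed
    qed
  qed
  show ?thesis using proper lsc coercive convex_u convex_d by blast
qed

end
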